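(* Let $\Omega=\bigcup_{j=1}^N\Omega_j$ be a domain with $N_{\max}$ layers and let $\mathbf u\in\mathcal V_{N_{\max}}$. Then $T\mathbf u\in\mathcal C_{N_{\max}}$.
   Context: **Geometry.** $N>1$, and $\Omega_1,\dots,\Omega_N\subset\mathbb R^2$ are open disks of radii $r_i>0$ such that $\Omega=\bigcup_{i=1}^N\Omega_i$ is connected and at least two of the disks intersect. Standing assumptions: (A1) if $\Omega_i\cap\Omega_j\neq\emptyset$ ($i\ne j$), there are sets of positive (arclength) measure $\Gamma_i\subset\partial\Omega_i\cap\Omega_j$ and $\Gamma_j\subset\partial\Omega_j\cap\Omega_i$ with $\Gamma_i\cap\Omega_k=\emptyset=\Gamma_j\cap\Omega_k$ for all $k\in\{1,\dots,N\}\setminus\{i,j\}$; (A2) $\Omega_{i_1}\cap\Omega_{i_2}\cap\Omega_{i_3}\cap\Omega_{i_4}=\emptyset$ for all distinct $i_1,i_2,i_3,i_4$. **Boundaries and skeletons.** For each $j$: $\Gamma_j^{\rm ext}=\partial\Omega_j\cap\partial\Omega$, $\Gamma_j^{\rm int}=\overline{\partial\Omega_j\setminus\Gamma_j^{\rm ext}}$, $N_j=\{i\ne j:\Omega_i\cap\Omega_j\ne\emptyset\}$, and for $k\in N_j$, $N_{jk}=(N_j\cap N_k)\cup\{0\}$. For $k\in N_j$, $i\in N_{jk}$ (interiors relative to $\partial\Omega_j$): $\Gamma_j^{k,i}={\rm int}\{x\in\partial\Omega_j: x\in\Omega_k\cap\Omega_i\}$ if $i\neq0$, and $\Gamma_j^{k,0}={\rm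 int}\{x\in\partial\Omega_j: x\in\Omega_k,\ x\notin\Omega_\ell\ \forall \ell\in N_j\setminus\{k\}\}$. For $k\in N_j$: $\mathcal S_{j,k}=\overline{\bigcup_{i\in N_{jk}}\Gamma_k^{j,i}}$ (the part of $\partial\Omega_k$ lying in $\overline{\Omega_j}$, obtained as the closure of the part in $\Omega_j$) and $\mathcal S^{\rm int}_{j,k}=\mathcal S_{j,k}\setminus\partial\Omega_j$. The skeleton and interior skeleton of $\Omega_j$ are $\mathcal S_j=\bigcup_{k\in N_j}\mathcal S_{j,k}$ and $\mathcal S_j^{\rm int}=\bigcup_{k\in N_j}\mathcal S_{j,k}^{\rm int}$. For $\mathbf v=(\mathbf v_1,\dots,\mathbf v_N)$ with $\mathbf v_j\in L^\infty(\mathcal S_j)$ (arclength measure), $\|\mathbf v\|_\infty=\max_j{\rm ess\,sup}_{\mathcal S_j}|\mathbf v_j|$. **Partition of unity.** Fixed functions $\chi_j^k:\partial\Omega_j\to\mathbb R$ ($k\in N_j$), continuous on ${\rm int}(\Gamma_j^{\rm int})$ (interior relative to $\partial\Omega_j$), with $\chi_j^k=1$ on $\overline{\Gamma_j^{k,0}}\setminus\Gamma_j^{\rm ext}$, $\chi_j^k\in[0,1]$ on $\overline{\Gamma_j^{k,i}}\setminus\Gamma_j^{\rm ext}$ for $0\ne i\in N_{jk}$, $\chi_j^k=0$ otherwise, and $\sum_{k\in N_j}\chi_j^k=1$ on ${\rm int}(\Gamma_j^{\rm int})$. (If $\Gamma_j^{\rm ext}$ has an isolated point, the prescription at that point is modified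 by making at least one $\chi_j^k$ nonzero there, keeping the continuity requirement.) **Iteration operator.** For a non-empty open $\Gamma_j\subseteq\partial\Omega_j$ and $\lambda\in L^2(\Gamma_j)$, $\mathcal E_j(\lambda)\in C^0(\Omega_j)$ is the harmonic extension (Poisson integral): the solution of $\Delta w=0$ in $\Omega_j$, $w=\lambda$ on $\Gamma_j$, $w=0$ on $\partial\Omega_j\setminus\Gamma_j$. $\mathcal R_j(w)=w|_{\mathcal S_j}$ is the restriction to $\mathcal S_j$ (for $w$ continuous in $\Omega_j$ with piecewise continuous values on $\partial\Omega_j$). $T=(T_{ij})_{i,j=1}^N$ has $T_{ij}=P_{ij}$ if $j\in N_i$ and $T_{ij}=0$ otherwise, where $P_{ij}\mathbf v_j=\mathcal R_i(\mathcal E_i(\mathbf v_j|_{\mathcal S_{j,i}}\,\chi_i^j|_{\mathcal S_{j,i}}))$. Thus $(T\mathbf v)_i=\sum_{j\in N_i}P_{ij}\mathbf v_j$; $T$ acts on families $\mathbf v$ with $\mathbf v_j\in C^0(\mathcal S_j^{\rm int})\cap L^\infty(\mathcal S_j)$. **Layers.** The graph of $\Omega$ has vertices $\mathcal V=\{1,\dots,N\}$ and edges $\{(i,j):j\in N_i\}$; $i$ is a boundary node if $\partial\Omega_i\cap\partial\Omega$ has positive measure. $\mathcal L_1$ is the set of boundary nodes. For $m>1$, let $\mathcal W_m=\mathcal V\setminus\bigcup_{k<m}\mathcal L_k$; if $\mathcal W_m\neq\emptyset$, $\mathcal L_m$ is the set of boundary nodes of the graph on $\mathcal W_m$, i.e.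 of $i\in\mathcal W_m$ such that $\partial\Omega_i\cap\partial(\bigcup_{\ell\in\mathcal W_m}\Omega_\ell)$ has positive measure. $N_{\max}$ is the total number of layers. **Sets $\mathcal V_n,\mathcal C_n$.** For $1\le n\le N_{\max}$: $\mathcal V_n$ is the set of $\mathbf v\in\prod_{j}C^0(\mathcal S_j^{\rm int})$ with $\|\mathbf v\|_\infty\le1$, $\mathbf v_j(x)<1$ for all $x\in\mathcal S_j^{\rm int}$ and all $j\in\bigcup_{k=1}^n\mathcal L_k$, and $\mathbf v_j=1$ on $\mathcal S_j$ for all $j\in\bigcup_{k=n+1}^{N_{\max}}\mathcal L_k$. $\mathcal C_n$ is the set of $\mathbf v\in\prod_{j}C^0(\mathcal S_j^{\rm int})$ with $\|\mathbf v\|_\infty\le1$ and ${\rm ess\,sup}_{\mathcal S_j}\mathbf v_j<1$ for all $j\in\bigcup_{k=1}^n\mathcal L_k$. Elements of $L^\infty(\mathcal S_j)$ are identified up to null sets. *)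

theory Defs
  imports "HOL-Analysis.Analysis" "HOL-Probability.Essential_Supremum"
begin

text \<open>
  The plane is \<^typ>\<open>complex\<close>. Disks are indexed by \<open>{1..N}\<close>, so that the index 0 is free for its
  special role in \<open>\<Gamma>\<^sub>j\<^sup>k\<^sup>,\<^sup>0\<close>.
\<close>

text \<open>Arclength on a circle, as the image of Lebesgue measure under the unit-speed
  parametrisation.\<close>

definition circle_measure :: "complex \<Rightarrow> real \<Rightarrow> complex measure" where
  "circle_measure a \<rho> =
     distr (restrict_space lborel {0..<2 * pi * \<rho>}) borel (\<lambda>s. a + of_real \<rho> * cis (s / \<rho>))"

definition poisson_kernel :: "complex \<Rightarrow> real \<Rightarrow> complex \<Rightarrow> complex \<Rightarrow> real" where
  "poisson_kernel a \<rho> x y = (\<rho>\<^sup>2 - (dist x a)\<^sup>2) / (2 * pi * \<rho> * (dist x y)\<^sup>2)"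

text \<open>The harmonic extension into the disk of the datum \<open>\<lambda>\<close> on \<open>\<Gamma>\<close>, extended by 0 to the rest of
  the circle; off the open disk it is given by the boundary datum itself.\<close>

definition harmonic_extension ::
  "complex \<Rightarrow> real \<Rightarrow> complex set \<Rightarrow> (complex \<Rightarrow> real) \<Rightarrow> complex \<Rightarrow> real" where
  "harmonic_extension a \<rho> \<Gamma> lam x =
     (if x \<in> ball a \<rho> then LINT y:\<Gamma>|circle_measure a \<rho>. poisson_kernel a \<rho> x y * lam y
      else if x \<in> \<Gamma> then lam x else 0)"

locale disks =
  fixes N :: nat and c :: "nat \<Rightarrow> complex" and r :: "nat \<Rightarrow> real"
begin

definition disk :: "nat \<Rightarrow> complex set" where
  "disk i = ball (c i) (r i)"

definition \<Omega> :: "complex set" where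
  "\<Omega> = (\<Union>i\<in>{1..N}. disk i)"

abbreviation bd :: "nat \<Rightarrow> complex set" where
  "bd i \<equiv> frontier (disk i)"

abbreviation arc_measure :: "nat \<Rightarrow> complex measure" where
  "arc_measure i \<equiv> circle_measure (c i) (r i)"

definition admissible :: bool where
  "admissible \<longleftrightarrow>
     N > 1 \<and> (\<forall>i\<in>{1..N}. r i > 0) \<and> connected \<Omega> \<and>
     (\<exists>i\<in>{1..N}. \<exists>j\<in>{1..N}. i \<noteq> j \<and> disk i \<inter> disk j \<noteq> {}) \<and>
     (\<forall>i\<in>{1..N}. \<forall>j\<in>{1..N}. i \<noteq> j \<and> disk i \<inter> disk j \<noteq> {} \<longrightarrow>
        (\<exists>Gi Gj. Gi \<in> sets borel \<and> Gj \<in> sets borel \<and>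
           Gi \<subseteq> bd i \<inter> disk j \<and> Gj \<subseteq> bd j \<inter> disk i \<and>
           emeasure (arc_measure i) Gi > 0 \<and> emeasure (arc_measure j) Gj > 0 \<and>
           (\<forall>k\<in>{1..N} - {i, j}. Gi \<inter> disk k = {} \<and> Gj \<inter> disk k = {}))) \<and>
     (\<forall>i1\<in>{1..N}. \<forall>i2\<in>{1..N}. \<forall>i3\<in>{1..N}. \<forall>i4\<in>{1..N}. distinct [i1, i2, i3, i4] \<longrightarrow>
        disk i1 \<inter> disk i2 \<inter> disk i3 \<inter> disk i4 = {})"

definition relint :: "nat \<Rightarrow> complex set \<Rightarrow> complex set" where
  "relint j A = (top_of_set (bd j)) interior_of A"

definition ext_bd :: "nat \<Rightarrow> complex set" where
  "ext_bd j = bd j \<inter> frontier \<Omega>"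

definition int_bd :: "nat \<Rightarrow> complex set" where
  "int_bd j = closure (bd j - ext_bd j)"

definition nbrs :: "nat \<Rightarrow> nat set" where
  "nbrs j = {i \<in> {1..N}. i \<noteq> j \<and> disk i \<inter> disk j \<noteq> {}}"

definition nbrs0 :: "nat \<Rightarrow> nat \<Rightarrow> nat set" where
  "nbrs0 j k = (nbrs j \<inter> nbrs k) \<union> {0}"

text \<open>\<open>bd_arc j k i\<close> is \<open>\<Gamma>\<^sub>j\<^sup>k\<^sup>,\<^sup>i\<close>, a subset of the boundary of disk \<open>j\<close>.\<close>

definition bd_arc :: "nat \<Rightarrow> nat \<Rightarrow> nat \<Rightarrow> complex set" where
  "bd_arc j k i = relint j
     (if i \<noteq> 0 then {x \<in> bd j. x \<in> disk k \<inter> disk i}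
      else {x \<in> bd j. x \<in> disk k \<and> (\<forall>l\<in>nbrs j - {k}. x \<notin> disk l)})"

text \<open>\<open>skel2 j k\<close> is \<open>\<S>\<^sub>j\<^sub>,\<^sub>k\<close>, a subset of the boundary of disk \<open>k\<close> (not \<open>j\<close>).\<close>

definition skel2 :: "nat \<Rightarrow> nat \<Rightarrow> complex set" where
  "skel2 j k = closure (\<Union>i\<in>nbrs0 j k. bd_arc k j i)"

definition skel2_int :: "nat \<Rightarrow> nat \<Rightarrow> complex set" where
  "skel2_int j k = skel2 j k - bd j"

definition skel :: "nat \<Rightarrow> complex set" where
  "skel j = (\<Union>k\<in>nbrs j. skel2 j k)"

definition skel_int :: "nat \<Rightarrow> complex set" where
  "skel_int j = (\<Union>k\<in>nbrs j. skel2_int j k)"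

text \<open>Arclength on the union of the circles is the sum of the arclengths on the single circles,
  because distinct circles meet in at most two points (and no two circles coincide in an
  admissible configuration).\<close>

definition arclength :: "complex measure" where
  "arclength = measure_of UNIV (sets borel) (\<lambda>A. \<Sum>k\<in>{1..N}. emeasure (arc_measure k) A)"

lemma sets_arclength: "sets arclength = sets borel"
  unfolding arclength_def
  by (metis sets.sets_measure_of_eq space_borel)

lemma emeasure_arclength:
  assumes "A \<in> sets borel"
  shows "emeasure arclength A = (\<Sum>k\<in>{1..N}. emeasure (arc_measure k) A)"
proof -
  have sb: "sets (arc_measure k) = sets borel" for k
    by (simp add: circle_measure_def)
  have "countably_additive (sets borel) (\<lambda>A. \<Sum>k\<in>{1..N}. emeasure (arc_measure k) A)"
  proof (rule countably_additiveI)
    fix F :: "nat \<Rightarrow> complex set"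
    assume F: "range F \<subseteq> sets borel" "disjoint_family F"
    have "(\<Sum>n. \<Sum>k\<in>{1..N}. emeasure (arc_measure k) (F n)) =
          (\<Sum>k\<in>{1..N}. \<Sum>n. emeasure (arc_measure k) (F n))"
      by (rule suminf_sum) simp
    also have "\<dots> = (\<Sum>k\<in>{1..N}. emeasure (arc_measure k) (\<Union> (range F)))"
      using F by (intro sum.cong refl suminf_emeasure) (auto simp: sb)
    finally show "(\<Sum>n. \<Sum>k\<in>{1..N}. emeasure (arc_measure k) (F n)) =
          (\<Sum>k\<in>{1..N}. emeasure (arc_measure k) (\<Union> (range F)))" .
  qed
  moreover have "positive (sets borel) (\<lambda>A. \<Sum>k\<in>{1..N}. emeasure (arc_measure k) A)"
    by (simp add: positive_def)
  ultimately show ?thesis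
    using assms sets.sigma_algebra_axioms[of "borel :: complex measure"]
    by (simp add: arclength_def emeasure_measure_of_sigma)
qed

abbreviation skel_measure :: "nat \<Rightarrow> complex measure" where
  "skel_measure j \<equiv> restrict_space arclength (skel j)"

text \<open>A family \<open>v\<close> is given by representatives \<open>v j\<close>, of which only the values on \<open>skel j\<close> matter.
  As \<open>esssup\<close> is infinite for non-measurable functions, a finite norm includes measurability.\<close>

definition sup_norm :: "(nat \<Rightarrow> complex \<Rightarrow> real) \<Rightarrow> ereal" where
  "sup_norm v = Max ((\<lambda>j. esssup (skel_measure j) (\<lambda>x. ereal \<bar>v j x\<bar>)) ` {1..N})"

text \<open>An isolated point of \<open>ext_bd j\<close> lies in the relative interior of \<open>int_bd j\<close>, where
  \<open>chi j k x = 0\<close> for all \<open>k\<close> would contradict the summation to 1; hence the exception for such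
  points. Continuity is required there as well.\<close>

definition partition_of_unity :: "(nat \<Rightarrow> nat \<Rightarrow> complex \<Rightarrow> real) \<Rightarrow> bool" where
  "partition_of_unity chi \<longleftrightarrow> (\<forall>j\<in>{1..N}.
     (\<forall>k\<in>nbrs j.
        continuous_on (relint j (int_bd j)) (chi j k) \<and>
        (\<forall>x\<in>closure (bd_arc j k 0) - ext_bd j. chi j k x = 1) \<and>
        (\<forall>i\<in>nbrs0 j k - {0}. \<forall>x\<in>closure (bd_arc j k i) - ext_bd j. 0 \<le> chi j k x \<and> chi j k x \<le> 1) \<and>
        (\<forall>x\<in>bd j. x \<notin> (\<Union>i\<in>nbrs0 j k. closure (bd_arc j k i) - ext_bd j) \<and>
            \<not> (x isolated_in ext_bd j) \<longrightarrow> chi j k x = 0)) \<and>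
     (\<forall>x. (x isolated_in ext_bd j) \<longrightarrow> (\<exists>k\<in>nbrs j. chi j k x \<noteq> 0)) \<and>
     (\<forall>x\<in>relint j (int_bd j). (\<Sum>k\<in>nbrs j. chi j k x) = 1))"

definition skel_restrict :: "nat \<Rightarrow> (complex \<Rightarrow> real) \<Rightarrow> complex \<Rightarrow> real" where
  "skel_restrict j w = (\<lambda>x. if x \<in> skel j then w x else 0)"

definition P_op ::
  "(nat \<Rightarrow> nat \<Rightarrow> complex \<Rightarrow> real) \<Rightarrow> nat \<Rightarrow> nat \<Rightarrow> (complex \<Rightarrow> real) \<Rightarrow> complex \<Rightarrow> real" where
  "P_op chi i j f =
     skel_restrict i (harmonic_extension (c i) (r i) (skel2 j i) (\<lambda>y. f y * chi i j y))"

definition T_entry ::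
  "(nat \<Rightarrow> nat \<Rightarrow> complex \<Rightarrow> real) \<Rightarrow> nat \<Rightarrow> nat \<Rightarrow> (complex \<Rightarrow> real) \<Rightarrow> complex \<Rightarrow> real" where
  "T_entry chi i j f = (if j \<in> nbrs i then P_op chi i j f else (\<lambda>x. 0))"

definition T_op ::
  "(nat \<Rightarrow> nat \<Rightarrow> complex \<Rightarrow> real) \<Rightarrow> (nat \<Rightarrow> complex \<Rightarrow> real) \<Rightarrow> nat \<Rightarrow> complex \<Rightarrow> real" where
  "T_op chi v = (\<lambda>i x. \<Sum>j\<in>{1..N}. T_entry chi i j (v j) x)"

definition boundary_nodes :: "nat set \<Rightarrow> nat set" where
  "boundary_nodes W =
     {i \<in> W. emeasure (arc_measure i) (bd i \<inter> frontier (\<Union>l\<in>W. disk l)) > 0}"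

text \<open>Layers are numbered from 1.\<close>

fun layer :: "nat \<Rightarrow> nat set" where
  "layer m = (if m = 0 then {} else boundary_nodes ({1..N} - (\<Union>k\<in>{1..<m}. layer k)))"

declare layer.simps [simp del]

definition remaining :: "nat \<Rightarrow> nat set" where
  "remaining m = {1..N} - (\<Union>k\<in>{1..<m}. layer k)"

definition N_max :: nat where
  "N_max = card {m. 1 \<le> m \<and> remaining m \<noteq> {}}"

definition V_set :: "nat \<Rightarrow> (nat \<Rightarrow> complex \<Rightarrow> real) set" where
  "V_set n = {v.
     (\<forall>j\<in>{1..N}. continuous_on (skel_int j) (v j)) \<and> sup_norm v \<le> 1 \<and>
     (\<forall>j\<in>(\<Union>k\<in>{1..n}. layer k). \<forall>x\<in>skel_int j. v j x < 1) \<and>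
     (\<forall>j\<in>(\<Union>k\<in>{n+1..N_max}. layer k). AE x in skel_measure j. v j x = 1)}"

definition C_set :: "nat \<Rightarrow> (nat \<Rightarrow> complex \<Rightarrow> real) set" where
  "C_set n = {v.
     (\<forall>j\<in>{1..N}. continuous_on (skel_int j) (v j)) \<and> sup_norm v \<le> 1 \<and>
     (\<forall>j\<in>(\<Union>k\<in>{1..n}. layer k). esssup (skel_measure j) (\<lambda>x. ereal (v j x)) < 1)}"

end

end

theory Submission
  imports Defs "HOL-Complex_Analysis.Cauchy_Integral_Formula"
begin

text \<open>
  On disk \<open>i\<close> all terms of \<open>(T u)\<^sub>i\<close> are Poisson integrals over the same circle, so \<open>(T u)\<^sub>i\<close> is the
  Poisson integral of one boundary function, the \<open>datum\<close> of \<open>u\<close>: the sum over the neighbours \<open>j\<close> of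
  \<open>u\<^sub>j\<close> weighted by \<open>\<chi>\<^sub>i\<^sup>j\<close> on \<open>\<S>\<^sub>j\<^sub>,\<^sub>i\<close>. Away from the finitely many points where circle \<open>i\<close> crosses another
  circle, the weights of the disks that contain the given point are nonnegative and sum to 1, unless
  no disk contains it and the datum is 0. Hence the datum is bounded by 1 in absolute
  value almost everywhere, and its Poisson integral is continuous on the disk and bounded by 1
  (\<open>continuous_on_poisson_integral\<close>, \<open>abs_poisson_integral_le\<close>).

  The point of the theorem is that \<open>(T u)\<^sub>i\<close> stays below 1 uniformly, although the \<open>u\<^sub>j\<close> are below 1
  only pointwise and may tend to 1 at the ends of the arcs that form the skeleton. The
  skeleton of disk \<open>i\<close> consists of arcs of circles \<open>k\<close> that run through disk \<open>i\<close> and end on circle \<open>i\<close>, at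
  crossings of the circles \<open>i\<close> and \<open>k\<close>. Since the crossing is transversal, such an arc approaches circle \<open>i\<close>
  nontangentially (\<open>crossing_nontangential\<close>). From a point of nontangential approach to \<open>z\<close>, a one-sided arc
  of circle \<open>i\<close> at \<open>z\<close> has harmonic measure bounded away from 0, so it suffices that the datum stays below
  some \<open>b < 1\<close> on one side of every crossing point \<open>z\<close> (\<open>poisson_integral_le_nontangential\<close>). The constants
  are valid along the whole arc, so that no separate argument for its interior points is needed.

  The right side of \<open>z\<close> is the one outside disk \<open>k\<close> (\<open>one_sided_bound\<close>). If every disk \<open>l\<close> that covers this
  side also contains \<open>z\<close>, then \<open>z\<close> is in the interior skeleton of each of them, and the continuity of \<open>u\<^sub>l\<close>
  at \<open>z\<close> together with \<open>u\<^sub>l z < 1\<close> gives the bound. Otherwise the arcs of circle \<open>i\<close> in disk \<open>k\<close> and in some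
  disk \<open>l\<close> abut at \<open>z\<close> from opposite sides. This cannot happen:
    \<^item> If \<open>z\<close> lies in a further disk \<open>m\<close>, then the arc of circle \<open>i\<close> in disk \<open>m\<close> ends inside both
      abutting arcs, for otherwise it would swallow one of them. So it is covered by them, and this
      contradicts the existence of a part of circle \<open>i\<close> that is covered by disk \<open>m\<close> alone
      (\<open>arc_subset_neighbouring_arcs\<close>).
    \<^item> If \<open>z\<close> lies in no disk, it is an isolated point of the exterior boundary, and the continuous
      weights of the partition of unity, each of which vanishes on one side of \<open>z\<close>, would all vanish
      at \<open>z\<close>, where their sum is 1 (\<open>no_isolated_ext_bd\<close>).

  Finally, pointwise \<open>u\<^sub>j < 1\<close> is available for all \<open>j\<close> because every nonempty subfamily of the disks has
  a boundary node, so that the layers exhaust the disks (\<open>Union_layers\<close>).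
\<close>

section \<open>Arclength on a circle\<close>

abbreviation circle_point :: "complex \<Rightarrow> real \<Rightarrow> real \<Rightarrow> complex" where
  "circle_point a \<rho> t \<equiv> a + of_real \<rho> * cis t"

lemma circle_point_add_2pi: "circle_point a \<rho> (t + 2 * pi * of_int n) = circle_point a \<rho> t"
  by (simp add: cis_multiple_2pi flip: cis_mult)

lemma norm_cis_diff: "cmod (cis s - cis t) = 2 * \<bar>sin ((s - t) / 2)\<bar>"
proof -
  have "(cmod (cis s - cis t))\<^sup>2 = 2 - 2 * cos (s - t)"
    using sin_cos_squared_add[of s] sin_cos_squared_add[of t]
    unfolding cmod_power2 by (simp add: cos_diff power2_eq_square algebra_simps)
  also have "cos (s - t) = 1 - 2 * (sin ((s - t) / 2))\<^sup>2"
    using cos_double_sin[of "(s - t) / 2"] by (simp only: mult_2 field_sum_of_halves)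
  finally have "(cmod (cis s - cis t))\<^sup>2 = (2 * \<bar>sin ((s - t) / 2)\<bar>)\<^sup>2"
    by (simp add: power_mult_distrib)
  then show ?thesis by (rule power2_eq_imp_eq) auto
qed

lemma sets_circle_measure [simp, measurable_cong]: "sets (circle_measure a \<rho>) = sets borel"
  by (simp add: circle_measure_def)

lemma space_circle_measure [simp]: "space (circle_measure a \<rho>) = UNIV"
  by (simp add: circle_measure_def)

lemma circle_param_measurable [measurable]:
  "(\<lambda>s. circle_point a \<rho> (s / \<rho>)) \<in> borel_measurable borel"
  unfolding divide_inverse by (intro borel_measurable_continuous_onI continuous_intros)

lemma circle_param_measurable' [measurable]:
  "(\<lambda>s. circle_point a \<rho> (s / \<rho>)) \<in> restrict_space lborel S \<rightarrow>\<^sub>M borel"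
  by (intro measurable_restrict_space1) simp

lemma AE_circle_measure_iff:
  assumes "Measurable.pred borel P"
  shows "(AE y in circle_measure a \<rho>. P y) \<longleftrightarrow>
    (AE s in lborel. s \<in> {0..<2 * pi * \<rho>} \<longrightarrow> P (circle_point a \<rho> (s / \<rho>)))"
  unfolding circle_measure_def using assms
  by (subst AE_distr_iff) (auto simp: AE_restrict_space_iff)

lemma AE_circle_measure_sphere:
  assumes "0 < \<rho>" shows "AE y in circle_measure a \<rho>. y \<in> sphere a \<rho>"
  using assms by (subst AE_circle_measure_iff) (auto simp: dist_norm norm_mult)

lemma AE_circle_measure_neq:
  assumes "0 < \<rho>" shows "AE y in circle_measure a \<rho>. y \<noteq> z"
proof -
  let ?f = "\<lambda>s. circle_point a \<rho> (s / \<rho>)"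
  let ?S = "?f -` {z} \<inter> {0..<2 * pi * \<rho>}"
  have "inj_on ?f {0..<2 * pi * \<rho>}"
  proof (rule linorder_inj_onI)
    fix s t assume st: "s < t" "s \<in> {0..<2 * pi * \<rho>}" "t \<in> {0..<2 * pi * \<rho>}"
    have "0 < (t / \<rho> - s / \<rho>) / 2" "(t / \<rho> - s / \<rho>) / 2 < pi"
      using st assms pi_gt_zero by (auto simp: divide_strict_right_mono simp flip: diff_divide_distrib)
         (simp add: pos_divide_less_eq mult_ac)
    then have "0 < cmod (cis (t / \<rho>) - cis (s / \<rho>))"
      using sin_gt_zero[of "(t / \<rho> - s / \<rho>) / 2"] unfolding norm_cis_diff by linarith
    then show "?f s \<noteq> ?f t" using assms by auto
  qed auto
  then have "finite ?S"
    by (rule finite_subset[OF inj_on_vimage_singleton]) simp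
  then have "AE s in lborel. s \<notin> ?S"
    by (intro AE_not_in countable_imp_null_set_lborel countable_finite)
  then show ?thesis
    by (subst AE_circle_measure_iff) auto
qed

lemma finite_measure_circle_measure: "finite_measure (circle_measure a \<rho>)"
proof -
  have "emeasure lborel {0..<2 * pi * \<rho>} < \<infinity>" by (cases "0 \<le> 2 * pi * \<rho>") auto
  then show ?thesis
    unfolding circle_measure_def
    by (intro finite_measure.finite_measure_distr finite_measureI)
       (auto simp: emeasure_restrict_space)
qed

text \<open>The loss of one half is the price for arcs that run across the starting point of the parametrisation:
  such an arc contains an interval of half its length on one side of that point.\<close>

lemma emeasure_circle_measure_ge:
  assumes "0 < \<rho>" "A \<in> sets borel" "0 \<le> \<delta>" "\<delta> \<le> 2 * pi"
    and "\<And>t. \<theta> < t \<Longrightarrow> t < \<theta> + \<delta> \<Longrightarrow> circle_point a \<rho> t \<in> A"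
  shows "ennreal (\<rho> * \<delta> / 2) \<le> emeasure (circle_measure a \<rho>) A"
proof -
  have 1: "ennreal (\<rho> * (q - p)) \<le> emeasure (circle_measure a \<rho>) A"
    if "0 \<le> p" "p \<le> q" "q \<le> 2 * pi" "\<And>t. p < t \<Longrightarrow> t < q \<Longrightarrow> circle_point a \<rho> t \<in> A" for p q
  proof -
    have "{\<rho> * p<..<\<rho> * q} \<subseteq> (\<lambda>s. circle_point a \<rho> (s / \<rho>)) -` A \<inter> {0..<2 * pi * \<rho>}"
    proof
      fix s assume s: "s \<in> {\<rho> * p<..<\<rho> * q}"
      have "\<rho> * q \<le> \<rho> * (2 * pi)" "0 \<le> \<rho> * p" using that assms(1) by simp_all
      then have "0 \<le> s" "s < 2 * pi * \<rho>" using s by (auto simp: mult_ac)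
      moreover have "p < s / \<rho>" "s / \<rho> < q" using s assms(1) by (auto simp: field_simps)
      ultimately show "s \<in> (\<lambda>s. circle_point a \<rho> (s / \<rho>)) -` A \<inter> {0..<2 * pi * \<rho>}"
        using that(4) by auto
    qed
    then have "emeasure lborel {\<rho> * p<..<\<rho> * q}
        \<le> emeasure lborel ((\<lambda>s. circle_point a \<rho> (s / \<rho>)) -` A \<inter> {0..<2 * pi * \<rho>})"
      using assms(2) by (intro emeasure_mono) (auto intro!: sets.Int simp: in_borel_measurable_borel measurable_sets[OF circle_param_measurable, simplified])
    moreover have "emeasure lborel {\<rho> * p<..<\<rho> * q} = ennreal (\<rho> * (q - p))"
      using that assms(1) by (subst emeasure_lborel_Ioo) (auto simp: algebra_simps)
    moreover have "emeasure (circle_measure a \<rho>) A = emeasure lborel ((\<lambda>s. circle_point a \<rho> (s / \<rho>)) -` A \<inter> {0..<2 * pi * \<rho>})"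
      unfolding circle_measure_def using assms(2)
      by (subst emeasure_distr) (auto simp: emeasure_restrict_space)
    ultimately show ?thesis by simp
  qed
  define n where "n = \<lfloor>\<theta> / (2 * pi)\<rfloor>"
  define \<theta>' where "\<theta>' = \<theta> - 2 * pi * n"
  have n: "of_int n \<le> \<theta> / (2 * pi)" "\<theta> / (2 * pi) < of_int n + 1" unfolding n_def by linarith+
  have th: "0 \<le> \<theta>'" "\<theta>' < 2 * pi" using n unfolding \<theta>'_def by (auto simp: field_simps)
  show ?thesis
  proof (cases "\<theta>' + \<delta> / 2 \<le> 2 * pi")
    case True
    have "circle_point a \<rho> t \<in> A" if "\<theta>' < t" "t < \<theta>' + \<delta> / 2" for t
      using assms(3) assms(5)[of "t + 2 * pi * n"] that unfolding circle_point_add_2pi by (auto simp: \<theta>'_def)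
    from 1[OF _ _ _ this, of "\<theta>'" "\<theta>' + \<delta>/2"] show ?thesis using True th assms by auto
  next
    case False
    have "circle_point a \<rho> t \<in> A" if "0 < t" "t < \<delta> / 2" for t
      using assms(3,4) assms(5)[of "t + 2 * pi * of_int (n + 1)"] that th False unfolding circle_point_add_2pi by (auto simp: \<theta>'_def algebra_simps)
    from 1[OF _ _ _ this, of 0 "\<delta>/2"] show ?thesis using th assms by auto
  qed
qed

lemma finite_null_circle_measure:
  assumes "0 < \<rho>" "finite F" shows "F \<in> null_sets (circle_measure a \<rho>)"
proof -
  have "{z} \<in> null_sets (circle_measure a \<rho>)" for z
    using AE_circle_measure_neq[OF assms(1), where a = a and z = z] by (subst (asm) AE_iff_null) auto
  then have "(\<Union>z\<in>F. {z}) \<in> null_sets (circle_measure a \<rho>)"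
    by (intro null_sets.finite_UN assms(2))
  then show ?thesis by simp
qed

text \<open>Families in \<open>V_set\<close> are continuous on the interior skeletons only, which miss finitely many points of
  the skeletons.\<close>

lemma borel_measurable_continuous_off_finite:
  fixes f :: "'a::euclidean_space \<Rightarrow> real"
  assumes "A \<in> sets borel" "continuous_on A f" "finite F" "S - F \<subseteq> A" "A \<subseteq> S"
  shows "(\<lambda>x. indicator S x * f x) \<in> borel_measurable borel"
proof (rule measurable_discrete_difference)
  show "(\<lambda>x. indicator A x *\<^sub>R f x) \<in> borel_measurable borel"
    using assms by (intro borel_measurable_continuous_on_indicator)
  show "countable F" using assms(3) by (rule countable_finite)
  show "indicator A x *\<^sub>R f x = indicator S x * f x" if "x \<notin> F" for x
    using that assms(4,5) by (auto simp: indicator_def)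
qed auto

section \<open>Poisson integrals of bounded data\<close>

text \<open>With \<open>e = \<rho> cis t\<close> and \<open>z = x - a\<close>, the kernel is \<open>1 / (2 \<pi> \<rho>)\<close> times the real part of \<open>(e + z) / (e - z)\<close>. On
  the circle, \<open>\<i> (e + z) / (e - z) dt\<close> is the differential form \<open>2 d\<zeta> / (\<zeta> - x) - d\<zeta> / (\<zeta> - a)\<close>, whose integral
  is \<open>2 \<pi> \<i>\<close> by Cauchy's formula.\<close>

lemma poisson_kernel_cis:
  assumes "0 < \<rho>" "x \<in> ball a \<rho>"
  shows "((\<lambda>t. \<rho> * poisson_kernel a \<rho> x (circle_point a \<rho> t)) has_integral 1) {0..2*pi}"
proof -
  define f where "f = (\<lambda>z. 2 / (z - x) - 1 / (z - a))"
  have xa: "cmod (x - a) < \<rho>" using assms by (simp add: dist_norm norm_minus_commute)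
  have 1: "((\<lambda>z. 1 / (z - w)) has_contour_integral 2 * of_real pi * \<i>) (circlepath a \<rho>)"
    if "cmod (w - a) < \<rho>" for w
    using Cauchy_integral_circlepath_simple[of "\<lambda>_. 1" a \<rho> w] that by simp
  have "(f has_contour_integral 2 * (2 * of_real pi * \<i>) - 2 * of_real pi * \<i>) (circlepath a \<rho>)"
    unfolding f_def using has_contour_integral_lmul[OF 1[OF xa], of 2] 1[of a] assms(1)
    by (intro has_contour_integral_diff) auto
  then have "((\<lambda>t. f (circle_point a \<rho> t) * \<rho> * \<i> * cis t) has_integral 2 * of_real pi * \<i>) {0..2 * pi}"
    unfolding circlepath_def
    by (subst (asm) has_contour_integral_part_circlepath_iff) (auto simp: algebra_simps)
  from has_integral_Im[OF this]
  have "((\<lambda>t. Im (f (circle_point a \<rho> t) * \<rho> * \<i> * cis t)) has_integral 2 * pi) {0..2 * pi}"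
    by simp
  from has_integral_mult_right[OF this, of "1/(2*pi)"]
  have *: "((\<lambda>t. 1/(2*pi) * Im (f (circle_point a \<rho> t) * \<rho> * \<i> * cis t)) has_integral 1) {0..2 * pi}"
    by simp
  have "1/(2*pi) * Im (f (circle_point a \<rho> t) * \<rho> * \<i> * cis t) = \<rho> * poisson_kernel a \<rho> x (circle_point a \<rho> t)" for t
  proof -
    define e where "e = of_real \<rho> * cis t"
    define z where "z = x - a"
    have e0: "e \<noteq> 0" "cmod e = \<rho>" using assms(1) by (auto simp: e_def norm_mult)
    have ne: "e - z \<noteq> 0" using xa e0 by (auto simp: z_def)
    have fe: "f (circle_point a \<rho> t) = 2 / (e - z) - 1 / e"
      by (simp add: f_def e_def z_def algebra_simps)
    have "f (circle_point a \<rho> t) * \<rho> * \<i> * cis t = (2 / (e - z) - 1 / e) * \<i> * e"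
      unfolding fe by (simp only: e_def mult_ac)
    also have "\<dots> = \<i> * ((e + z) / (e - z))"
      using ne e0(1) by (simp add: field_simps)
    finally have "Im (f (circle_point a \<rho> t) * \<rho> * \<i> * cis t) = Re ((e + z) / (e - z))"
      by (simp only: Im_i_times)
    also have "\<dots> = Re ((e + z) * cnj (e - z)) / (cmod (e - z))\<^sup>2"
      by (subst complex_div_cnj) (simp only: Re_divide_of_real flip: of_real_power)
    also have "Re ((e + z) * cnj (e - z)) = (cmod e)\<^sup>2 - (cmod z)\<^sup>2"
      by (simp add: cmod_power2) (simp add: power2_eq_square algebra_simps)
    finally have A: "Im (f (circle_point a \<rho> t) * \<rho> * \<i> * cis t) = (\<rho>\<^sup>2 - (cmod z)\<^sup>2) / (cmod (e - z))\<^sup>2"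
      using e0 by simp
    have B: "dist x (circle_point a \<rho> t) = cmod (e - z)" "dist x a = cmod z"
      by (simp_all add: dist_norm e_def z_def norm_minus_commute algebra_simps)
    show ?thesis unfolding A poisson_kernel_def B using assms(1) by simp
  qed
  with * show ?thesis by simp
qed

lemma poisson_kernel_measurable [measurable]: "poisson_kernel a \<rho> x \<in> borel_measurable borel"
  unfolding poisson_kernel_def by measurable

lemma poisson_kernel_bounds:
  assumes "0 < \<rho>" "dist x a \<le> s" "s < \<rho>" "y \<in> sphere a \<rho>"
  shows "0 \<le> poisson_kernel a \<rho> x y" "poisson_kernel a \<rho> x y \<le> \<rho>\<^sup>2 / (2 * pi * \<rho> * (\<rho> - s)\<^sup>2)"
proof -
  have 1: "(dist x a)\<^sup>2 \<le> \<rho>\<^sup>2" using assms by (intro power_mono) auto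
  then show "0 \<le> poisson_kernel a \<rho> x y" using assms(1) by (simp add: poisson_kernel_def)
  have "\<rho> \<le> dist x a + dist x y" using dist_triangle[of a y x] assms(4) by (simp add: dist_commute)
  then have "(\<rho> - s)\<^sup>2 \<le> (dist x y)\<^sup>2" using assms by (intro power_mono) auto
  then show "poisson_kernel a \<rho> x y \<le> \<rho>\<^sup>2 / (2 * pi * \<rho> * (\<rho> - s)\<^sup>2)"
    unfolding poisson_kernel_def using assms 1 by (intro frac_le mult_left_mono) auto
qed

lemma integrable_poisson_kernel_times:
  assumes "0 < \<rho>" "x \<in> ball a \<rho>" "h \<in> borel_measurable borel" "AE y in circle_measure a \<rho>. \<bar>h y\<bar> \<le> B"
  shows "integrable (circle_measure a \<rho>) (\<lambda>y. poisson_kernel a \<rho> x y * h y)"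
proof -
  interpret finite_measure "circle_measure a \<rho>" by (rule finite_measure_circle_measure)
  let ?C = "\<rho>\<^sup>2 / (2 * pi * \<rho> * (\<rho> - dist x a)\<^sup>2)"
  show ?thesis
  proof (rule integrable_const_bound[where B = "?C * B"])
    show "AE y in circle_measure a \<rho>. norm (poisson_kernel a \<rho> x y * h y) \<le> ?C * B"
      using AE_circle_measure_sphere[OF assms(1)] assms(4)
    proof eventually_elim
      case (elim y)
      then show ?case
        using poisson_kernel_bounds[of \<rho> x a "dist x a" y] assms(1,2) unfolding real_norm_def abs_mult
        by (intro mult_mono) (auto simp: dist_commute)
    qed
  qed (use assms(3) in measurable)
qed

lemma integral_poisson_kernel:
  assumes "0 < \<rho>" "x \<in> ball a \<rho>"
  shows "(LINT y|circle_measure a \<rho>. poisson_kernel a \<rho> x y) = 1"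
proof -
  let ?f = "\<lambda>s. poisson_kernel a \<rho> x (circle_point a \<rho> (s / \<rho>))"
  let ?I = "{0..<2 * pi * \<rho>}"
  have "((\<lambda>s. \<rho> * ?f s) has_integral \<rho>) {0..2 * pi * \<rho>}"
    using has_integral_stretch_real[OF poisson_kernel_cis[OF assms], of "1/\<rho>"] assms(1)
    by (simp add: mult.commute[of _ \<rho>])
  from has_integral_mult_right[OF this, of "1/\<rho>"]
  have "(?f has_integral 1) {0..2 * pi * \<rho>}" using assms(1) by simp
  then have 1: "(?f has_integral 1) ?I"
    by (rule has_integral_spike_set_eq[THEN iffD1, rotated 2])
       (auto intro!: negligible_subset[OF negligible_sing[of "2 * pi * \<rho>"]])
  have "dist a (circle_point a \<rho> t) = \<rho>" for t
    using assms(1) by (simp add: dist_norm norm_mult)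
  then have "dist x (circle_point a \<rho> t) \<noteq> 0" for t
    using assms(2) by (metis dist_eq_0_iff less_irrefl mem_ball)
  then have ne: "2 * pi * \<rho> * (dist x (circle_point a \<rho> t))\<^sup>2 \<noteq> 0" for t
    using assms(1) by (metis mult_eq_0_iff power_eq_0_iff pi_neq_zero zero_neq_numeral less_irrefl)
  have "continuous_on UNIV ?f"
    unfolding poisson_kernel_def
    by (intro continuous_intros ballI ne) (use assms(1) in simp)
  then have "continuous_on {0..2 * pi * \<rho>} ?f"
    by (rule continuous_on_subset) simp
  then have "set_integrable lborel {0..2 * pi * \<rho>} ?f"
    by (rule borel_integrable_atLeastAtMost')
  then have "set_integrable lborel ?I ?f"
    by (rule set_integrable_subset) auto
  from set_borel_integral_eq_integral(2)[OF this] 1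
  have "(LINT s:?I|lborel. ?f s) = 1" by (simp add: integral_unique)
  then show ?thesis
    unfolding circle_measure_def
    by (subst integral_distr) (auto simp: integral_restrict_space set_lebesgue_integral_def)
qed

lemma abs_poisson_integral_le:
  assumes "0 < \<rho>" "x \<in> ball a \<rho>" "h \<in> borel_measurable borel" "AE y in circle_measure a \<rho>. \<bar>h y\<bar> \<le> 1"
  shows "\<bar>LINT y|circle_measure a \<rho>. poisson_kernel a \<rho> x y * h y\<bar> \<le> 1"
proof -
  have "\<bar>LINT y|circle_measure a \<rho>. poisson_kernel a \<rho> x y * h y\<bar>
      \<le> (LINT y|circle_measure a \<rho>. \<bar>poisson_kernel a \<rho> x y * h y\<bar>)"
    using integral_abs_bound by blast
  also have "\<dots> \<le> (LINT y|circle_measure a \<rho>. poisson_kernel a \<rho> x y)"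
  proof (rule integral_mono_AE)
    show "integrable (circle_measure a \<rho>) (\<lambda>y. \<bar>poisson_kernel a \<rho> x y * h y\<bar>)"
      using integrable_poisson_kernel_times[OF assms] by (rule integrable_abs)
    show "integrable (circle_measure a \<rho>) (poisson_kernel a \<rho> x)"
      using integrable_poisson_kernel_times[OF assms(1,2), of "\<lambda>_. 1" 1] by simp
    show "AE y in circle_measure a \<rho>. \<bar>poisson_kernel a \<rho> x y * h y\<bar> \<le> poisson_kernel a \<rho> x y"
      using AE_circle_measure_sphere[OF assms(1)] assms(4)
    proof eventually_elim
      case (elim y)
      then show ?case
        using poisson_kernel_bounds(1)[of \<rho> x a "dist x a" y] assms(1,2)
        unfolding abs_mult by (subst abs_of_nonneg) (auto simp: dist_commute intro: mult_left_le)
    qed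
  qed
  finally show ?thesis using integral_poisson_kernel[OF assms(1,2)] by simp
qed

text \<open>Dominated convergence on smaller concentric disks, on which the kernel is bounded.\<close>

lemma continuous_on_poisson_integral:
  assumes "0 < \<rho>" "h \<in> borel_measurable borel" "AE y in circle_measure a \<rho>. \<bar>h y\<bar> \<le> 1"
  shows "continuous_on (ball a \<rho>) (\<lambda>x. LINT y|circle_measure a \<rho>. poisson_kernel a \<rho> x y * h y)"
proof -
  interpret finite_measure "circle_measure a \<rho>" by (rule finite_measure_circle_measure)
  let ?W = "\<lambda>x. LINT y|circle_measure a \<rho>. poisson_kernel a \<rho> x y * h y"
  have 1: "continuous_on (ball a s) ?W" if s: "s < \<rho>" for s
  proof (rule continuous_on_sequentiallyI)
    fix u x assume u: "\<forall>n. u n \<in> ball a s" and x: "x \<in> ball a s" and lim: "u \<longlonglongrightarrow> x"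
    let ?C = "\<rho>\<^sup>2 / (2 * pi * \<rho> * (\<rho> - s)\<^sup>2)"
    show "(\<lambda>n. ?W (u n)) \<longlonglongrightarrow> ?W x"
    proof (rule integral_dominated_convergence[where w = "\<lambda>_. ?C"])
      show "AE y in circle_measure a \<rho>. (\<lambda>n. poisson_kernel a \<rho> (u n) y * h y) \<longlonglongrightarrow> poisson_kernel a \<rho> x y * h y"
        using AE_circle_measure_sphere[OF assms(1)]
      proof eventually_elim
        case (elim y)
        then have "x \<noteq> y" using x s by auto
        then show ?case unfolding poisson_kernel_def using assms(1)
          by (intro tendsto_intros lim) auto
      qed
      show "AE y in circle_measure a \<rho>. norm (poisson_kernel a \<rho> (u n) y * h y) \<le> ?C" for n
        using AE_circle_measure_sphere[OF assms(1)] assms(3)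
      proof eventually_elim
        case (elim y)
        have "dist (u n) a \<le> s" using u by (auto simp: dist_commute less_imp_le)
        from poisson_kernel_bounds[OF assms(1) this s elim(1)] elim(2)
        have "norm (poisson_kernel a \<rho> (u n) y * h y) \<le> ?C * 1"
          unfolding real_norm_def abs_mult by (intro mult_mono) auto
        then show ?case by simp
      qed
    qed (use assms(2) in measurable)
  qed
  have "isCont ?W x" if "x \<in> ball a \<rho>" for x
  proof -
    let ?s = "(dist a x + \<rho>) / 2"
    have "?s < \<rho>" "x \<in> ball a ?s" using that by auto
    then show ?thesis using 1 continuous_on_eq_continuous_at[OF open_ball, of a ?s] by blast
  qed
  then show ?thesis by (simp add: continuous_at_imp_continuous_on)
qed

text \<open>At distance \<open>d\<close> from the circle, and at distance at most \<open>K d\<close> from \<open>z\<close>, the kernel is of order \<open>1 / d\<close> at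
  all boundary points within distance \<open>d\<close> of \<open>z\<close>.\<close>

lemma poisson_kernel_ge_nontangential:
  assumes "0 < \<rho>" "0 \<le> K" "x \<in> ball a \<rho>" "dist x z \<le> K * (\<rho> - dist x a)" "dist z y \<le> \<rho> - dist x a"
    and "y \<in> sphere a \<rho>"
  shows "1 / (2 * pi * (K + 1)\<^sup>2 * (\<rho> - dist x a)) \<le> poisson_kernel a \<rho> x y"
proof -
  define d where "d = \<rho> - dist x a"
  have d: "0 < d" using assms(3) by (simp add: d_def dist_commute)
  have "dist x y \<le> (K + 1) * d"
    using dist_triangle[of x y z] assms(4,5) by (simp add: d_def algebra_simps)
  then have le: "(dist x y)\<^sup>2 \<le> ((K + 1) * d)\<^sup>2" by (intro power_mono) auto
  have "x \<noteq> y" using assms(3,6) by auto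
  have "1 / (2 * pi * (K + 1)\<^sup>2 * d) = \<rho> * d / (2 * pi * \<rho> * ((K + 1) * d)\<^sup>2)"
    using d assms(1,2) by (simp add: power_mult_distrib) (simp add: power2_eq_square)
  also have "\<dots> \<le> (\<rho>\<^sup>2 - (dist x a)\<^sup>2) / (2 * pi * \<rho> * (dist x y)\<^sup>2)"
  proof (rule frac_le)
    have "\<rho>\<^sup>2 - (dist x a)\<^sup>2 = (\<rho> + dist x a) * d" by (simp add: d_def power2_eq_square algebra_simps)
    then show "\<rho> * d \<le> \<rho>\<^sup>2 - (dist x a)\<^sup>2" using d by simp
    then show "0 \<le> \<rho>\<^sup>2 - (dist x a)\<^sup>2" using d assms(1) by (smt (verit) mult_pos_pos)
  qed (use le assms(1) \<open>x \<noteq> y\<close> in \<open>auto intro!: mult_left_mono\<close>)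
  finally show ?thesis unfolding poisson_kernel_def d_def .
qed

text \<open>Let \<open>d\<close> be the distance of \<open>x\<close> from the circle. The part of the one-sided arc within distance \<open>d\<close> of
  its end has length of order \<open>d\<close>, and the kernel is there of order \<open>1 / d\<close>. So this part
  has a harmonic measure seen from \<open>x\<close> that is bounded below independently of \<open>x\<close>, and the gap \<open>\<epsilon>\<close> on it is felt at \<open>x\<close>.\<close>

lemma poisson_integral_le_nontangential:
  assumes \<rho>: "0 < \<rho>" and h: "h \<in> borel_measurable borel" "AE y in circle_measure a \<rho>. \<bar>h y\<bar> \<le> 1"
    and "0 \<le> K" "0 < \<epsilon>" "0 < \<delta>" "\<sigma> = 1 \<or> \<sigma> = -1"
    and le: "\<And>t. 0 < t \<Longrightarrow> t < \<delta> \<Longrightarrow> h (circle_point a \<rho> (\<theta> + \<sigma> * t)) \<le> 1 - \<epsilon>"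
  shows "\<exists>b<1. \<forall>x\<in>ball a \<rho>. dist x (circle_point a \<rho> \<theta>) \<le> K * (\<rho> - dist x a) \<longrightarrow>
           (LINT y|circle_measure a \<rho>. poisson_kernel a \<rho> x y * h y) \<le> b"
proof -
  interpret finite_measure "circle_measure a \<rho>" by (rule finite_measure_circle_measure)
  define z where "z = circle_point a \<rho> \<theta>"
  define \<eta> where "\<eta> = min 1 \<delta>"
  have \<eta>: "0 < \<eta>" "\<eta> \<le> 1" "\<eta> \<le> \<delta>" using assms by (auto simp: \<eta>_def)
  \<comment> \<open>\<open>\<epsilon>\<close> times the kernel bound \<open>1 / (2 \<pi> (K + 1)\<^sup>2 d)\<close> times the bound \<open>\<eta> d / 2\<close> for the length of the arc\<close>
  define b where "b = 1 - \<epsilon> * \<eta> / (4 * pi * (K + 1)\<^sup>2)"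
  have "b < 1" using assms \<eta> by (simp add: b_def)
  moreover have "(LINT y|circle_measure a \<rho>. poisson_kernel a \<rho> x y * h y) \<le> b"
    if x: "x \<in> ball a \<rho>" and xz: "dist x z \<le> K * (\<rho> - dist x a)" for x
  proof -
    define d where "d = \<rho> - dist x a"
    have d: "0 < d" "d \<le> \<rho>" using x by (simp_all add: d_def dist_commute)
    define A where "A = {y. h y \<le> 1 - \<epsilon>} \<inter> cball z d"
    have A[measurable]: "A \<in> sets borel" unfolding A_def using h(1) by measurable
    have "ennreal (\<rho> * (\<eta> * d / \<rho>) / 2) \<le> emeasure (circle_measure a \<rho>) A"
    proof (rule emeasure_circle_measure_ge[where \<theta> = "if \<sigma> = 1 then \<theta> else \<theta> - \<eta> * d / \<rho>"])
      have "\<eta> * d \<le> 1 * \<rho>" using \<eta> d by (intro mult_mono) auto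
      then have "\<eta> * d / \<rho> \<le> 1" using \<rho> by (simp add: field_simps)
      then show "\<eta> * d / \<rho> \<le> 2 * pi" using pi_gt3 by linarith
      fix t assume t: "(if \<sigma> = 1 then \<theta> else \<theta> - \<eta> * d / \<rho>) < t" "t < (if \<sigma> = 1 then \<theta> else \<theta> - \<eta> * d / \<rho>) + \<eta> * d / \<rho>"
      define s where "s = \<sigma> * (t - \<theta>)"
      have s: "0 < s" "s < \<eta> * d / \<rho>" "t = \<theta> + \<sigma> * s" "\<bar>t - \<theta>\<bar> = s" using t assms(7) unfolding s_def by (auto split: if_splits)
      have "\<eta> * d \<le> \<delta> * \<rho>" using \<eta> d by (intro mult_mono) auto
      then have "\<eta> * d / \<rho> \<le> \<delta>" using \<rho> by (simp add: field_simps)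
      then have 1: "h (circle_point a \<rho> t) \<le> 1 - \<epsilon>" using le[of s] s by simp
      have "dist z (circle_point a \<rho> t) = \<rho> * cmod (cis \<theta> - cis t)"
        using \<rho> by (simp add: z_def dist_norm norm_mult flip: right_diff_distrib)
      also have "cmod (cis \<theta> - cis t) \<le> \<bar>t - \<theta>\<bar>"
        using abs_sin_x_le_abs_x[of "(\<theta> - t) / 2"] by (simp add: norm_cis_diff abs_minus_commute)
      also have "\<rho> * \<bar>t - \<theta>\<bar> \<le> \<eta> * d" using s \<rho> by (simp add: field_simps)
      also have "\<dots> \<le> d" using \<eta> d by simp
      finally show "circle_point a \<rho> t \<in> A" using 1 \<rho> by (simp add: A_def)
    qed (use \<rho> \<eta> d in auto)
    then have mA: "\<eta> * d / 2 \<le> measure (circle_measure a \<rho>) A"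
      using \<rho> \<eta> d by (simp add: emeasure_eq_measure)
    let ?k = "1 / (2 * pi * (K + 1)\<^sup>2 * d)"
    have k: "0 < ?k" using d assms(4) by (intro divide_pos_pos mult_pos_pos) auto
    note int = integrable_poisson_kernel_times[OF \<rho> x h] integrable_poisson_kernel_times[OF \<rho> x, of "\<lambda>_. 1" 1, simplified]
    have intA: "integrable (circle_measure a \<rho>) (\<lambda>y. indicator A y * (\<epsilon> * ?k))"
      by (intro Bochner_Integration.integrable_mult_left integrable_real_indicator) (auto simp: emeasure_eq_measure)
    have "\<epsilon> * \<eta> / (4 * pi * (K + 1)\<^sup>2) = \<epsilon> * ?k * (\<eta> * d / 2)"
      using d by (simp add: field_simps)
    also have "\<dots> \<le> \<epsilon> * ?k * measure (circle_measure a \<rho>) A"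
      using mA k assms(5) by (intro mult_left_mono) auto
    also have "\<dots> = (LINT y|circle_measure a \<rho>. indicator A y * (\<epsilon> * ?k))"
      by simp
    also have "\<dots> \<le> (LINT y|circle_measure a \<rho>. poisson_kernel a \<rho> x y - poisson_kernel a \<rho> x y * h y)"
    proof (rule integral_mono_AE)
      show "AE y in circle_measure a \<rho>. indicator A y * (\<epsilon> * ?k) \<le> poisson_kernel a \<rho> x y - poisson_kernel a \<rho> x y * h y"
        using AE_circle_measure_sphere[OF \<rho>] h(2)
      proof eventually_elim
        case (elim y)
        have P0: "0 \<le> poisson_kernel a \<rho> x y"
          using poisson_kernel_bounds(1)[of \<rho> x a "dist x a" y] \<rho> x elim(1) by (auto simp: dist_commute)
        show ?case
        proof (cases "y \<in> A")
          case True
          then have "?k \<le> poisson_kernel a \<rho> x y" "\<epsilon> \<le> 1 - h y"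
            using poisson_kernel_ge_nontangential[OF \<rho> assms(4) x xz _ elim(1)] by (auto simp: A_def d_def)
          then have "?k * \<epsilon> \<le> poisson_kernel a \<rho> x y * (1 - h y)"
            using k assms(5) P0 by (intro mult_mono) auto
          then show ?thesis using True by (simp add: algebra_simps)
        next
          case False
          have "0 \<le> poisson_kernel a \<rho> x y * (1 - h y)" using P0 elim(2) by (intro mult_nonneg_nonneg) auto
          then show ?thesis using False by (simp add: algebra_simps)
        qed
      qed
    qed (intro intA Bochner_Integration.integrable_diff int)+
    also have "\<dots> = 1 - (LINT y|circle_measure a \<rho>. poisson_kernel a \<rho> x y * h y)"
      using int by (subst Bochner_Integration.integral_diff) (simp_all add: integral_poisson_kernel[OF \<rho> x])
    finally show ?thesis by (simp add: b_def)
  qed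
  ultimately show ?thesis unfolding z_def by blast
qed

section \<open>Two crossing circles\<close>

lemma circle_point_in_sphere: "0 < \<rho> \<Longrightarrow> circle_point a \<rho> t \<in> sphere a \<rho>"
  by (simp add: dist_norm norm_mult)

lemma dist_circle_point: "0 < \<rho> \<Longrightarrow> dist (circle_point a \<rho> s) (circle_point a \<rho> t) = 2 * \<rho> * \<bar>sin ((s - t) / 2)\<bar>"
  by (simp add: dist_norm norm_mult norm_cis_diff flip: right_diff_distrib)

lemma sphere_circle_pointE:
  assumes "0 < \<rho>" "y \<in> sphere a \<rho>"
  obtains t where "0 \<le> t" "t < 2 * pi" "y = circle_point a \<rho> (\<theta> + t)"
proof -
  define z where "z = (y - a) / (of_real \<rho> * cis \<theta>)"
  have "cmod z = 1" using assms by (simp add: z_def norm_divide norm_mult dist_norm norm_minus_commute)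
  then have z: "z = cis (Arg2pi z)" using Arg2pi_eq[of z] by (simp add: cis_conv_exp)
  have "y = a + of_real \<rho> * cis \<theta> * z" using assms(1) by (simp add: z_def)
  also have "\<dots> = circle_point a \<rho> (\<theta> + Arg2pi z)" by (subst z) (simp add: mult.assoc cis_mult)
  finally show thesis using that[of "Arg2pi z"] Arg2pi[of z] by auto
qed

text \<open>Strict triangle inequalities: the circles meet in two points and are not tangent.\<close>

definition crossing :: "complex \<Rightarrow> real \<Rightarrow> complex \<Rightarrow> real \<Rightarrow> bool" where
  "crossing a \<rho> b s \<longleftrightarrow> 0 < \<rho> \<and> 0 < s \<and> \<bar>\<rho> - s\<bar> < dist a b \<and> dist a b < \<rho> + s"

lemma crossing_sym: "crossing a \<rho> b s \<Longrightarrow> crossing b s a \<rho>"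
  by (auto simp: crossing_def dist_commute)

text \<open>The law of cosines: \<open>\<phi>\<close> is the direction from \<open>a\<close> to \<open>b\<close>, and the circles cross at the angles \<open>\<phi> \<plusminus> \<alpha>\<close>.\<close>

lemma crossing_power:
  assumes "crossing a \<rho> b s"
  obtains \<phi> \<alpha> where "0 < \<alpha>" "\<alpha> < pi"
    "\<And>t. s\<^sup>2 - (dist (circle_point a \<rho> (\<phi> + t)) b)\<^sup>2 = 2 * \<rho> * dist a b * (cos t - cos \<alpha>)"
proof -
  define d where "d = dist a b"
  have pos: "0 < \<rho>" "0 < s" "0 < d" using assms by (auto simp: crossing_def d_def)
  define q where "q = (\<rho>\<^sup>2 + d\<^sup>2 - s\<^sup>2) / (2 * \<rho> * d)"
  have "\<bar>\<rho> - d\<bar> < \<bar>s\<bar>" using assms by (auto simp: crossing_def d_def)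
  then have "(\<rho> - d)\<^sup>2 < s\<^sup>2" by (metis power2_abs power_strict_mono abs_ge_zero zero_less_numeral)
  then have q1: "q < 1" using pos by (simp add: q_def field_simps power2_eq_square)
  have "s\<^sup>2 < (\<rho> + d)\<^sup>2" using assms pos by (intro power_strict_mono) (auto simp: crossing_def d_def)
  then have q2: "-1 < q" using pos by (simp add: q_def field_simps power2_eq_square)
  have \<alpha>: "0 < arccos q" "arccos q < pi" "cos (arccos q) = q"
    using arccos_lt_bounded[OF q2 q1] cos_arccos[of q] q1 q2 by auto
  have b: "b - a = of_real d * cis (Arg (b - a))"
    using pos(3) by (metis cis_conv_exp Arg_eq_0 complex_norm_eq_1_exp d_def dist_commute dist_norm rcis_def rcis_cmod_Arg)
  show thesis
  proof (rule that[OF \<alpha>(1,2)])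
    fix t
    let ?x = "circle_point a \<rho> (Arg (b - a) + t)"
    have "?x - b = of_real \<rho> * cis (Arg (b - a) + t) - (b - a)" by simp
    also have "\<dots> = cis (Arg (b - a)) * (of_real \<rho> * cis t - of_real d)"
      by (subst b) (simp add: cis_mult[symmetric] algebra_simps)
    finally have "(dist ?x b)\<^sup>2 = (cmod (of_real \<rho> * cis t - of_real d))\<^sup>2"
      by (simp add: dist_norm norm_mult)
    also have "\<dots> = (\<rho> * cos t - d)\<^sup>2 + (\<rho> * sin t)\<^sup>2"
      by (simp add: cmod_power2)
    also have "\<dots> = \<rho>\<^sup>2 * ((sin t)\<^sup>2 + (cos t)\<^sup>2) + d\<^sup>2 - 2 * \<rho> * d * cos t"
      by algebra
    finally have "(dist ?x b)\<^sup>2 = \<rho>\<^sup>2 + d\<^sup>2 - 2 * \<rho> * d * cos t" by simp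
    moreover have "2 * \<rho> * d * q = \<rho>\<^sup>2 + d\<^sup>2 - s\<^sup>2" using pos by (simp add: q_def)
    ultimately have "s\<^sup>2 - (dist ?x b)\<^sup>2 = 2 * \<rho> * d * cos t - 2 * \<rho> * d * q" by simp
    then show "s\<^sup>2 - (dist ?x b)\<^sup>2 = 2 * \<rho> * dist a b * (cos t - cos (arccos q))"
      unfolding \<alpha>(3) d_def by (simp add: right_diff_distrib)
  qed
qed

text \<open>The power of \<open>x\<close> with respect to the other circle is a multiple of a difference of two cosines, hence of a
  product of two sines, and these sines are proportional to the chords from \<open>x\<close> to the two crossing points.\<close>

lemma crossing_chord:
  assumes "crossing a \<rho> b s"
  obtains z z' where "z \<noteq> z'" "z \<in> sphere a \<rho> \<inter> sphere b s" "z' \<in> sphere a \<rho> \<inter> sphere b s"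
    "\<And>x. x \<in> sphere a \<rho> \<Longrightarrow> \<rho> * \<bar>s\<^sup>2 - (dist x b)\<^sup>2\<bar> = dist a b * dist x z * dist x z'"
proof -
  from crossing_power[OF assms] obtain \<phi> \<alpha> where \<alpha>: "0 < \<alpha>" "\<alpha> < pi"
    and pw: "\<And>t. s\<^sup>2 - (dist (circle_point a \<rho> (\<phi> + t)) b)\<^sup>2 = 2 * \<rho> * dist a b * (cos t - cos \<alpha>)" by metis
  have pos: "0 < \<rho>" "0 < s" using assms by (auto simp: crossing_def)
  define z where "z = circle_point a \<rho> (\<phi> + \<alpha>)"
  define z' where "z' = circle_point a \<rho> (\<phi> + - \<alpha>)"
  show thesis
  proof (rule that)
    have "dist z z' = 2 * \<rho> * \<bar>sin \<alpha>\<bar>"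
      unfolding z_def z'_def dist_circle_point[OF pos(1)] by simp
    then have "0 < dist z z'" using sin_gt_zero[OF \<alpha>] pos by simp
    then show "z \<noteq> z'" by (rule zero_less_dist_iff[THEN iffD1])
    have "s\<^sup>2 - (dist z b)\<^sup>2 = 0" "s\<^sup>2 - (dist z' b)\<^sup>2 = 0"
      unfolding z_def z'_def pw by simp_all
    then have "dist z b = s" "dist z' b = s"
      using pos by (auto intro: power2_eq_imp_eq)
    then show "z \<in> sphere a \<rho> \<inter> sphere b s" "z' \<in> sphere a \<rho> \<inter> sphere b s"
      using circle_point_in_sphere[OF pos(1)] unfolding z_def z'_def by (simp_all add: dist_commute)
    fix x assume "x \<in> sphere a \<rho>"
    then obtain t where x: "x = circle_point a \<rho> (\<phi> + t)" by (rule sphere_circle_pointE[OF pos(1)])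
    have "dist x z = 2 * \<rho> * \<bar>sin ((t - \<alpha>) / 2)\<bar>" "dist x z' = 2 * \<rho> * \<bar>sin ((t + \<alpha>) / 2)\<bar>"
      unfolding x z_def z'_def dist_circle_point[OF pos(1)] by simp_all
    moreover have "\<bar>cos t - cos \<alpha>\<bar> = 2 * \<bar>sin ((t + \<alpha>) / 2)\<bar> * \<bar>sin ((t - \<alpha>) / 2)\<bar>"
      using sin_minus[of "(t - \<alpha>) / 2"] unfolding cos_diff_cos minus_divide_left minus_diff_eq
      by (simp add: abs_mult)
    moreover have "\<bar>s\<^sup>2 - (dist x b)\<^sup>2\<bar> = 2 * \<rho> * dist a b * \<bar>cos t - cos \<alpha>\<bar>"
      unfolding x pw using pos by (simp add: abs_mult)
    ultimately show "\<rho> * \<bar>s\<^sup>2 - (dist x b)\<^sup>2\<bar> = dist a b * dist x z * dist x z'"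
      by simp
  qed
qed

text \<open>By \<open>crossing_chord\<close> the power of \<open>x\<close>, which is at most \<open>2 \<rho>\<close> times the distance of \<open>x\<close> from the circle
  around \<open>a\<close>, is proportional to the product of the distances from \<open>x\<close> to the crossing points. For the
  farther one this distance is at least half the distance of the two crossing points. Measuring from the
  nearer crossing point makes \<open>K\<close> valid on the whole arc.\<close>

lemma crossing_nontangential:
  assumes "crossing a \<rho> b s"
  obtains K where "0 \<le> K" "\<And>x. x \<in> sphere b s \<inter> ball a \<rho> \<Longrightarrow>
    \<exists>z \<in> sphere a \<rho> \<inter> sphere b s. dist x z \<le> K * (\<rho> - dist x a)"
proof -
  from crossing_chord[OF crossing_sym[OF assms]]
  obtain z z' where z: "z \<noteq> z'" "z \<in> sphere b s \<inter> sphere a \<rho>" "z' \<in> sphere b s \<inter> sphere a \<rho>"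
    "\<And>x. x \<in> sphere b s \<Longrightarrow> s * \<bar>\<rho>\<^sup>2 - (dist x a)\<^sup>2\<bar> = dist b a * dist x z * dist x z'" by metis
  define K where "K = 4 * \<rho> * s / (dist b a * dist z z')"
  have pos: "0 < \<rho>" "0 < s" "0 < dist b a" "0 < dist z z'" using assms z(1) by (auto simp: crossing_def)
  have near: "dist x w \<le> K * (\<rho> - dist x a)"
    if x: "x \<in> sphere b s \<inter> ball a \<rho>" and le: "dist x w \<le> dist x w'" and ww: "{w, w'} = {z, z'}" for x w w'
  proof -
    have "dist z z' = dist w w'" using ww by (auto simp: doubleton_eq_iff dist_commute)
    then have "dist z z' \<le> 2 * dist x w'" using le dist_triangle2[of w w' x] by (simp add: dist_commute)
    then have "dist b a * dist x w * dist z z' \<le> dist b a * dist x w * (2 * dist x w')"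
      by (intro mult_left_mono) auto
    also have "\<dots> = 2 * (dist b a * dist x z * dist x z')" using ww by (auto simp: doubleton_eq_iff)
    also have "\<dots> = 2 * s * \<bar>\<rho>\<^sup>2 - (dist x a)\<^sup>2\<bar>" using z(4)[of x] x by simp
    also have "\<rho>\<^sup>2 - (dist x a)\<^sup>2 = (\<rho> + dist x a) * (\<rho> - dist x a)"
      by (simp add: power2_eq_square algebra_simps)
    also have "2 * s * \<bar>(\<rho> + dist x a) * (\<rho> - dist x a)\<bar> \<le> 2 * s * (2 * \<rho> * (\<rho> - dist x a))"
      using x pos by (intro mult_left_mono) (auto simp: abs_mult dist_commute intro!: mult_right_mono)
    finally show ?thesis using pos by (simp add: K_def field_simps)
  qed
  show thesis
  proof (rule that[of K])
    show "0 \<le> K" using pos by (simp add: K_def)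
    fix x assume x: "x \<in> sphere b s \<inter> ball a \<rho>"
    then show "\<exists>z \<in> sphere a \<rho> \<inter> sphere b s. dist x z \<le> K * (\<rho> - dist x a)"
      using near[OF x, of z z'] near[OF x, of z' z] z(2,3) by (metis Int_commute insert_commute linear)
  qed
qed

lemma crossing_finite:
  assumes "crossing a \<rho> b s"
  shows "finite (sphere a \<rho> \<inter> sphere b s)"
proof -
  from crossing_chord[OF assms]
  obtain z z' where z: "\<And>x. x \<in> sphere a \<rho> \<Longrightarrow> \<rho> * \<bar>s\<^sup>2 - (dist x b)\<^sup>2\<bar> = dist a b * dist x z * dist x z'" by metis
  have "x \<in> {z, z'}" if "x \<in> sphere a \<rho> \<inter> sphere b s" for x
    using z[of x] that assms by (auto simp: crossing_def dist_commute)
  then have "sphere a \<rho> \<inter> sphere b s \<subseteq> {z, z'}" by blast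
  then show ?thesis by (rule finite_subset) simp
qed

lemma cos_less_cos_iff_abs:
  assumes "0 < \<alpha>" "\<alpha> < pi"
  shows "\<bar>u\<bar> \<le> 2 * pi - \<alpha> \<Longrightarrow> cos \<alpha> < cos u \<longleftrightarrow> \<bar>u\<bar> < \<alpha>"
    and "\<bar>u\<bar> < 2 * pi - \<alpha> \<Longrightarrow> cos \<alpha> \<le> cos u \<longleftrightarrow> \<bar>u\<bar> \<le> \<alpha>"
proof -
  define v where "v = (if \<bar>u\<bar> \<le> pi then \<bar>u\<bar> else 2 * pi - \<bar>u\<bar>)"
  have "cos v = cos u" by (auto simp: v_def cos_diff abs_if)
  moreover assume "\<bar>u\<bar> \<le> 2 * pi - \<alpha>"
  then have v: "0 \<le> v" "v \<le> pi" using assms by (auto simp: v_def)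
  ultimately show "cos \<alpha> < cos u \<longleftrightarrow> \<bar>u\<bar> < \<alpha>"
    using cos_mono_less_eq[of \<alpha> v] assms \<open>\<bar>u\<bar> \<le> 2 * pi - \<alpha>\<close> by (auto simp: v_def split: if_splits)
next
  define v where "v = (if \<bar>u\<bar> \<le> pi then \<bar>u\<bar> else 2 * pi - \<bar>u\<bar>)"
  have "cos v = cos u" by (auto simp: v_def cos_diff abs_if)
  moreover assume "\<bar>u\<bar> < 2 * pi - \<alpha>"
  then have v: "0 \<le> v" "v \<le> pi" using assms by (auto simp: v_def)
  ultimately show "cos \<alpha> \<le> cos u \<longleftrightarrow> \<bar>u\<bar> \<le> \<alpha>"
    using cos_mono_le_eq[of \<alpha> v] assms \<open>\<bar>u\<bar> < 2 * pi - \<alpha>\<close> by (auto simp: v_def split: if_splits)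
qed

text \<open>In the angle \<open>t\<close> counted from an arbitrary base point, the other disk cuts out the arc \<open>\<bar>u + t\<bar> < \<alpha>\<close>,
  up to multiples of a full turn.\<close>

lemma crossing_arc:
  assumes "crossing a \<rho> b s"
  obtains \<alpha> u where "0 < \<alpha>" "\<alpha> < pi" "\<bar>u\<bar> \<le> pi"
    "\<And>t. circle_point a \<rho> (\<theta> + t) \<in> ball b s \<longleftrightarrow> cos \<alpha> < cos (u + t)"
    "\<And>t. circle_point a \<rho> (\<theta> + t) \<in> cball b s \<longleftrightarrow> cos \<alpha> \<le> cos (u + t)"
proof -
  from crossing_power[OF assms] obtain \<phi> \<alpha> where \<alpha>: "0 < \<alpha>" "\<alpha> < pi"
    and pw: "\<And>t. s\<^sup>2 - (dist (circle_point a \<rho> (\<phi> + t)) b)\<^sup>2 = 2 * \<rho> * dist a b * (cos t - cos \<alpha>)" by metis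
  have pos: "0 < \<rho>" "0 < s" "0 < dist a b" using assms by (auto simp: crossing_def)
  define w where "w = (\<theta> - \<phi>) / (2 * pi)"
  define n where "n = round w"
  define u where "u = \<theta> - \<phi> - 2 * pi * of_int n"
  have n: "\<bar>w - of_int n\<bar> \<le> 1 / 2"
    using of_int_round_abs_le[of w] by (simp add: n_def abs_minus_commute)
  have "\<theta> - \<phi> = 2 * pi * w" by (simp add: w_def)
  then have "u = 2 * pi * (w - of_int n)" by (simp add: u_def right_diff_distrib)
  then have "\<bar>u\<bar> = 2 * pi * \<bar>w - of_int n\<bar>" by (simp add: abs_mult)
  also have "\<dots> \<le> 2 * pi * (1 / 2)" using n by (intro mult_left_mono) auto
  finally have "\<bar>u\<bar> \<le> pi" by simp
  have cp: "circle_point a \<rho> (\<theta> + t) = circle_point a \<rho> (\<phi> + (u + t))" for t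
    using circle_point_add_2pi[of a \<rho> "\<phi> + (u + t)" n] by (simp add: u_def algebra_simps)
  define k where "k = 2 * \<rho> * dist a b"
  have "0 < k" using pos by (simp add: k_def)
  then have "0 < s\<^sup>2 - (dist (circle_point a \<rho> (\<theta> + t)) b)\<^sup>2 \<longleftrightarrow> cos \<alpha> < cos (u + t)"
    "0 \<le> s\<^sup>2 - (dist (circle_point a \<rho> (\<theta> + t)) b)\<^sup>2 \<longleftrightarrow> cos \<alpha> \<le> cos (u + t)" for t
    unfolding cp pw k_def[symmetric] by (simp_all add: zero_less_mult_iff zero_le_mult_iff)
  moreover have "0 < s\<^sup>2 - (dist x b)\<^sup>2 \<longleftrightarrow> x \<in> ball b s" "0 \<le> s\<^sup>2 - (dist x b)\<^sup>2 \<longleftrightarrow> x \<in> cball b s" for x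
    using pos power_mono_iff[of "dist x b" s 2] power_strict_mono[of "dist x b" s 2] power_mono[of s "dist x b" 2]
      power_less_imp_less_base[of "dist x b" 2 s]
    by (auto simp: dist_commute not_less)
  ultimately show thesis using that[OF \<alpha> \<open>\<bar>u\<bar> \<le> pi\<close>] by simp
qed

lemma arc_around_point:
  assumes "crossing a \<rho> b s" "circle_point a \<rho> \<theta> \<in> ball b s"
  obtains p q where "0 < p" "0 < q" "p + q < 2 * pi"
    "\<forall>t\<in>{-p<..<q}. circle_point a \<rho> (\<theta> + t) \<in> ball b s"
    "\<forall>t\<in>{q..2 * pi - p}. circle_point a \<rho> (\<theta> + t) \<notin> ball b s"
proof -
  from crossing_arc[OF assms(1), of \<theta>] obtain \<alpha> u where \<alpha>: "0 < \<alpha>" "\<alpha> < pi" and u: "\<bar>u\<bar> \<le> pi"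
    and b: "\<And>t. circle_point a \<rho> (\<theta> + t) \<in> ball b s \<longleftrightarrow> cos \<alpha> < cos (u + t)" by metis
  have "circle_point a \<rho> (\<theta> + 0) \<in> ball b s" using assms(2) by simp
  then have au: "\<bar>u\<bar> < \<alpha>" unfolding b using cos_less_cos_iff_abs(1)[OF \<alpha>, of u] u \<alpha> by auto
  have "circle_point a \<rho> (\<theta> + t) \<in> ball b s" if "t \<in> {-(u + \<alpha>)<..<\<alpha> - u}" for t
    unfolding b using cos_less_cos_iff_abs(1)[OF \<alpha>, of "u + t"] \<alpha> that by auto
  moreover have "circle_point a \<rho> (\<theta> + t) \<notin> ball b s" if "t \<in> {\<alpha> - u..2 * pi - (u + \<alpha>)}" for t
    unfolding b using cos_less_cos_iff_abs(1)[OF \<alpha>, of "u + t"] \<alpha> that by auto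
  ultimately show thesis using that[of "u + \<alpha>" "\<alpha> - u"] \<alpha> au by auto
qed

text \<open>The arc leaves its endpoint in the direction \<open>\<sigma>\<close>. In the opposite direction the circle stays outside
  even the closed disk for a while, because the arc is less than a full turn.\<close>

lemma arc_from_endpoint:
  assumes "crossing a \<rho> b s" "circle_point a \<rho> \<theta> \<in> sphere b s"
  obtains \<sigma> L where "\<sigma> = 1 \<or> \<sigma> = -1" "0 < L" "L < 2 * pi"
    "\<forall>t\<in>{0<..<2 * pi}. circle_point a \<rho> (\<theta> + \<sigma> * t) \<in> ball b s \<longleftrightarrow> t < L"
    "\<forall>\<^sub>F t in at_right 0. circle_point a \<rho> (\<theta> - \<sigma> * t) \<notin> cball b s"
proof -
  from crossing_arc[OF assms(1), of \<theta>] obtain \<alpha> u where \<alpha>: "0 < \<alpha>" "\<alpha> < pi" and u: "\<bar>u\<bar> \<le> pi"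
    and b: "\<And>t. circle_point a \<rho> (\<theta> + t) \<in> ball b s \<longleftrightarrow> cos \<alpha> < cos (u + t)"
    and cb: "\<And>t. circle_point a \<rho> (\<theta> + t) \<in> cball b s \<longleftrightarrow> cos \<alpha> \<le> cos (u + t)" by metis
  have "circle_point a \<rho> (\<theta> + 0) \<in> cball b s" "circle_point a \<rho> (\<theta> + 0) \<notin> ball b s"
    using assms(2) by auto
  then have "cos u = cos \<alpha>" unfolding b cb by simp
  then have au: "\<bar>u\<bar> = \<alpha>" using cos_less_cos_iff_abs[OF \<alpha>, of u] u \<alpha> by linarith
  define \<sigma> :: real where "\<sigma> = (if u < 0 then 1 else -1)"
  have \<sigma>: "\<sigma> = 1 \<or> \<sigma> = -1" by (simp add: \<sigma>_def)
  have inside: "circle_point a \<rho> (\<theta> + \<sigma> * t) \<in> ball b s \<longleftrightarrow> t < 2 * \<alpha>" if t: "t \<in> {0<..<2 * pi}" for t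
  proof -
    have c: "\<bar>u + \<sigma> * t\<bar> = \<bar>t - \<alpha>\<bar>" using au by (auto simp: \<sigma>_def)
    have "\<bar>t - \<alpha>\<bar> < 2 * pi - \<alpha>" using t \<alpha> by auto
    then show ?thesis
      unfolding b using cos_less_cos_iff_abs(1)[OF \<alpha>, of "u + \<sigma> * t"] t unfolding c by auto
  qed
  have "0 < 2 * pi - 2 * \<alpha>" using \<alpha> by simp
  from eventually_at_right_real[OF this]
  have "\<forall>\<^sub>F t in at_right 0. circle_point a \<rho> (\<theta> - \<sigma> * t) \<notin> cball b s"
  proof eventually_elim
    case (elim t)
    have c: "\<bar>u + - (\<sigma> * t)\<bar> = t + \<alpha>" using au elim by (auto simp: \<sigma>_def)
    have "\<not> cos \<alpha> \<le> cos (u + - (\<sigma> * t))"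
      using cos_less_cos_iff_abs(2)[OF \<alpha>, of "u + - (\<sigma> * t)"] elim unfolding c by auto
    then show ?case using cb[of "- (\<sigma> * t)"] by simp
  qed
  then show thesis using that[OF \<sigma>, of "2 * \<alpha>"] inside \<alpha> by simp
qed

lemma circle_point_tendsto: "((\<lambda>t. circle_point a \<rho> (\<theta> + \<sigma> * t)) \<longlongrightarrow> circle_point a \<rho> \<theta>) (at_right 0)"
  by (rule tendsto_eq_intros refl | simp)+

text \<open>The circle changes between the inside and the outside of the other disk at two points only,
  so on either side of any point it is eventually in one of the two.\<close>

lemma arc_germ:
  assumes "crossing a \<rho> b s" "\<sigma> = 1 \<or> \<sigma> = -1"
  shows "(\<forall>\<^sub>F t in at_right 0. circle_point a \<rho> (\<theta> + \<sigma> * t) \<in> ball b s) \<or>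
         (\<forall>\<^sub>F t in at_right 0. circle_point a \<rho> (\<theta> + \<sigma> * t) \<notin> cball b s)"
proof -
  consider "circle_point a \<rho> \<theta> \<in> ball b s" | "circle_point a \<rho> \<theta> \<in> - cball b s" | "circle_point a \<rho> \<theta> \<in> sphere b s"
    by force
  then show ?thesis
  proof cases
    case 1
    from topological_tendstoD[OF circle_point_tendsto open_ball this] show ?thesis by blast
  next
    case 2
    from topological_tendstoD[OF circle_point_tendsto open_Compl[OF closed_cball] this]
    show ?thesis unfolding Compl_iff by (rule disjI2)
  next
    case 3
    obtain \<tau> L where \<tau>: "\<tau> = 1 \<or> \<tau> = -1" and L: "0 < L" "L < 2 * pi"
      and in_L: "\<forall>t\<in>{0<..<2 * pi}. circle_point a \<rho> (\<theta> + \<tau> * t) \<in> ball b s \<longleftrightarrow> t < L"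
      and out: "\<forall>\<^sub>F t in at_right 0. circle_point a \<rho> (\<theta> - \<tau> * t) \<notin> cball b s"
      by (rule arc_from_endpoint[OF assms(1) 3])
    show ?thesis
    proof (cases "\<sigma> = \<tau>")
      case True
      have "\<forall>\<^sub>F t in at_right 0. circle_point a \<rho> (\<theta> + \<sigma> * t) \<in> ball b s"
        using eventually_at_right_real[OF L(1)] by eventually_elim (use L True in_L in auto)
      then show ?thesis ..
    next
      case False
      then have "\<sigma> = - \<tau>" using assms(2) \<tau> by auto
      then show ?thesis using out by simp
    qed
  qed
qed

lemma arc_germ_outside:
  assumes "crossing a \<rho> b s" "circle_point a \<rho> \<theta> \<notin> ball b s"
  shows "\<exists>\<sigma>. (\<sigma> = 1 \<or> \<sigma> = -1) \<and> (\<forall>\<^sub>F t in at_right 0. circle_point a \<rho> (\<theta> + \<sigma> * t) \<notin> cball b s)"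
proof (cases "circle_point a \<rho> \<theta> \<in> sphere b s")
  case True
  obtain \<sigma> where "\<sigma> = 1 \<or> \<sigma> = -1" "\<forall>\<^sub>F t in at_right 0. circle_point a \<rho> (\<theta> - \<sigma> * t) \<notin> cball b s"
    by (rule arc_from_endpoint[OF assms(1) True])
  then show ?thesis by (intro exI[of _ "- \<sigma>"]) auto
next
  case False
  then have "circle_point a \<rho> \<theta> \<in> - cball b s" using assms(2) by auto
  from topological_tendstoD[OF circle_point_tendsto open_Compl[OF closed_cball] this, of 1]
  show ?thesis unfolding Compl_iff by blast
qed

text \<open>The arcs in the disks \<open>k\<close> and \<open>l\<close> leave \<open>\<theta>\<close> in opposite directions. The arc in disk \<open>m\<close> runs around \<open>\<theta>\<close>; as
  it contains neither of the two, it ends before them in both directions.\<close>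

lemma arc_subset_neighbouring_arcs:
  assumes m: "crossing a \<rho> bm sm" "circle_point a \<rho> \<theta> \<in> ball bm sm"
    and k: "Lk < 2 * pi" "circle_point a \<rho> \<theta> \<notin> ball bk sk" "\<not> sphere a \<rho> \<inter> ball bk sk \<subseteq> ball bm sm"
      "\<And>t. 0 < t \<Longrightarrow> t < 2 * pi \<Longrightarrow> circle_point a \<rho> (\<theta> - t) \<in> ball bk sk \<longleftrightarrow> t < Lk"
    and l: "Ll < 2 * pi" "circle_point a \<rho> \<theta> \<notin> ball bl sl" "\<not> sphere a \<rho> \<inter> ball bl sl \<subseteq> ball bm sm"
      "\<And>t. 0 < t \<Longrightarrow> t < 2 * pi \<Longrightarrow> circle_point a \<rho> (\<theta> + t) \<in> ball bl sl \<longleftrightarrow> t < Ll"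
  shows "sphere a \<rho> \<inter> ball bm sm \<subseteq> ball bk sk \<union> ball bl sl \<union> {circle_point a \<rho> \<theta>}"
proof -
  have \<rho>: "0 < \<rho>" using m(1) by (simp add: crossing_def)
  obtain p q where pq: "0 < p" "0 < q" "p + q < 2 * pi"
    and m_in: "\<forall>t\<in>{-p<..<q}. circle_point a \<rho> (\<theta> + t) \<in> ball bm sm"
    and m_out: "\<forall>t\<in>{q..2 * pi - p}. circle_point a \<rho> (\<theta> + t) \<notin> ball bm sm"
    by (rule arc_around_point[OF m])
  have wrap: "circle_point a \<rho> (\<theta> - (2 * pi - t)) = circle_point a \<rho> (\<theta> + t)" for t
  proof -
    have "\<theta> + t = \<theta> - (2 * pi - t) + 2 * pi * of_int 1" by simp
    then show ?thesis by (simp only: circle_point_add_2pi)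
  qed
  have q: "q < Ll"
  proof (rule ccontr)
    assume "\<not> q < Ll"
    have "y \<in> ball bm sm" if y: "y \<in> sphere a \<rho> \<inter> ball bl sl" for y
    proof -
      obtain t where t: "0 \<le> t" "t < 2 * pi" "y = circle_point a \<rho> (\<theta> + t)"
        using y sphere_circle_pointE[OF \<rho>] by blast
      have "t \<noteq> 0" using y t l(2) by auto
      then have "t < Ll" using l(4)[of t] t y by simp
      then show ?thesis using bspec[OF m_in, of t] t pq \<open>\<not> q < Ll\<close> by simp
    qed
    then show False using l(3) by blast
  qed
  have p: "p < Lk"
  proof (rule ccontr)
    assume "\<not> p < Lk"
    have "y \<in> ball bm sm" if y: "y \<in> sphere a \<rho> \<inter> ball bk sk" for y
    proof -
      obtain t where t: "0 \<le> t" "t < 2 * pi" "y = circle_point a \<rho> (\<theta> + t)"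
        using y sphere_circle_pointE[OF \<rho>] by blast
      have "t \<noteq> 0" using y t k(2) by auto
      then have "2 * pi - t < Lk" using k(4)[of "2 * pi - t"] t y wrap by simp
      then have "- (2 * pi - t) \<in> {-p<..<q}" using t pq \<open>\<not> p < Lk\<close> by auto
      from bspec[OF m_in this] show ?thesis unfolding t(3) by (simp only: wrap flip: diff_conv_add_uminus)
    qed
    then show False using k(3) by blast
  qed
  show ?thesis
  proof
    fix y assume y: "y \<in> sphere a \<rho> \<inter> ball bm sm"
    obtain t where t: "0 \<le> t" "t < 2 * pi" "y = circle_point a \<rho> (\<theta> + t)"
      using y sphere_circle_pointE[OF \<rho>] by blast
    consider "t = 0" | "0 < t" "t < q" | "q \<le> t" "t \<le> 2 * pi - p" | "2 * pi - p < t" using t(1) by linarith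
    then show "y \<in> ball bk sk \<union> ball bl sl \<union> {circle_point a \<rho> \<theta>}"
    proof cases
      case 1 then show ?thesis using t by simp
    next
      case 2 then show ?thesis using l(4)[of t] t q by simp
    next
      case 3 then show ?thesis using bspec[OF m_out, of t] y t by auto
    next
      case 4 then show ?thesis using k(4)[of "2 * pi - t"] t p pq wrap by simp
    qed
  qed
qed

section \<open>Skeletons in an admissible configuration\<close>

locale admissible_disks = disks +
  assumes admissible: admissible
begin

lemma radius_pos: "i \<in> {1..N} \<Longrightarrow> 0 < r i"
  using admissible by (simp add: admissible_def)

lemma bd_eq: "i \<in> {1..N} \<Longrightarrow> bd i = sphere (c i) (r i)"
  using radius_pos by (simp add: disk_def)

lemma nbrs_subset: "nbrs i \<subseteq> {1..N}"
  by (auto simp: nbrs_def)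

lemma nbrs_in: "j \<in> nbrs i \<Longrightarrow> j \<in> {1..N}"
  by (auto simp: nbrs_def)

lemma finite_nbrs [simp]: "finite (nbrs i)"
  using nbrs_subset by (rule finite_subset) simp

lemma nbrs_sym: "i \<in> {1..N} \<Longrightarrow> j \<in> nbrs i \<Longrightarrow> i \<in> nbrs j"
  by (auto simp: nbrs_def)

lemma private_arcE:
  assumes "i \<in> {1..N}" "j \<in> nbrs i"
  obtains G where "G \<in> sets borel" "G \<subseteq> bd i \<inter> disk j" "emeasure (arc_measure i) G > 0"
    "\<forall>k\<in>{1..N} - {i, j}. G \<inter> disk k = {}"
proof -
  have A: "\<forall>i\<in>{1..N}. \<forall>j\<in>{1..N}. i \<noteq> j \<and> disk i \<inter> disk j \<noteq> {} \<longrightarrow>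
        (\<exists>Gi Gj. Gi \<in> sets borel \<and> Gj \<in> sets borel \<and>
           Gi \<subseteq> bd i \<inter> disk j \<and> Gj \<subseteq> bd j \<inter> disk i \<and>
           emeasure (arc_measure i) Gi > 0 \<and> emeasure (arc_measure j) Gj > 0 \<and>
           (\<forall>k\<in>{1..N} - {i, j}. Gi \<inter> disk k = {} \<and> Gj \<inter> disk k = {}))"
    using admissible[unfolded admissible_def] by (elim conjE)
  have j: "j \<in> {1..N}" "i \<noteq> j \<and> disk i \<inter> disk j \<noteq> {}" using assms(2) by (auto simp: nbrs_def)
  from mp[OF bspec[OF bspec[OF A assms(1)] j(1)] j(2)]
  obtain G G' where G: "G \<in> sets borel" "G \<subseteq> bd i \<inter> disk j" "emeasure (arc_measure i) G > 0"
    "\<forall>k\<in>{1..N} - {i, j}. G \<inter> disk k = {} \<and> G' \<inter> disk k = {}" by (elim exE conjE)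
  show thesis by (rule that[OF G(1-3)]) (use G(4) in simp)
qed

lemma arc_not_subset:
  assumes "i \<in> {1..N}" "j \<in> nbrs i" "k \<in> nbrs i" "k \<noteq> j"
  shows "\<not> bd i \<inter> disk j \<subseteq> disk k"
proof -
  obtain G where "G \<subseteq> bd i \<inter> disk j" "emeasure (arc_measure i) G > 0"
    "\<forall>k\<in>{1..N} - {i, j}. G \<inter> disk k = {}" by (rule private_arcE[OF assms(1,2)])
  moreover have "k \<in> {1..N} - {i, j}" using assms by (auto simp: nbrs_def)
  moreover from calculation have "G \<noteq> {}" by auto
  ultimately show ?thesis by blast
qed

text \<open>A point of circle \<open>i\<close> in disk \<open>j\<close> shows that disk \<open>j\<close> is not contained in disk \<open>i\<close>, and vice versa; a
  common point of the two disks gives the remaining inequality.\<close>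

lemma crossing_nbrs:
  assumes "i \<in> {1..N}" "j \<in> nbrs i"
  shows "crossing (c i) (r i) (c j) (r j)"
proof -
  have j: "j \<in> {1..N}" "i \<in> nbrs j" using nbrs_in[OF assms(2)] nbrs_sym[OF assms] by this+
  have r: "0 < r i" "0 < r j" using radius_pos[OF assms(1)] radius_pos[OF j(1)] by this+
  have less: "r i < dist (c i) (c j) + r j" if ij: "i \<in> {1..N}" "j \<in> nbrs i" for i j
  proof -
    obtain G where "G \<subseteq> bd i \<inter> disk j" "emeasure (arc_measure i) G > 0" by (rule private_arcE[OF ij])
    moreover from this have "G \<noteq> {}" by auto
    ultimately obtain x where "x \<in> bd i" "x \<in> disk j" by blast
    then have "dist (c i) x = r i" "dist (c j) x < r j" using bd_eq[OF ij(1)] by (auto simp: disk_def)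
    then show ?thesis using dist_triangle2[of "c i" x "c j"] dist_triangle[of "c i" x "c j"] by linarith
  qed
  obtain x where "x \<in> disk i" "x \<in> disk j" using assms(2) by (auto simp: nbrs_def)
  then have "dist (c i) (c j) < r i + r j"
    using dist_triangle2[of "c i" "c j" x] by (simp add: disk_def)
  then show ?thesis using r less[OF assms] less[OF j] by (simp add: crossing_def dist_commute)
qed

lemma finite_bd_Int: "i \<in> {1..N} \<Longrightarrow> j \<in> nbrs i \<Longrightarrow> finite (bd i \<inter> bd j)"
  using crossing_finite[OF crossing_nbrs] bd_eq[of i] bd_eq[OF nbrs_in, of j i] by simp

lemma mem_relint: "x \<in> relint j A \<longleftrightarrow> (\<exists>U. open U \<and> x \<in> bd j \<and> x \<in> U \<and> bd j \<inter> U \<subseteq> A)"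
  unfolding relint_def interior_of_def openin_open by blast

lemma bd_arc_subset: "bd_arc i j k \<subseteq> bd i \<inter> disk j"
  unfolding bd_arc_def by (auto simp: mem_relint split: if_splits)

lemma bd_arc_nonzero: "k \<noteq> 0 \<Longrightarrow> bd_arc i j k = bd i \<inter> disk j \<inter> disk k"
proof -
  assume "k \<noteq> 0"
  have "open (disk j \<inter> disk k)" by (auto simp: disk_def)
  then show ?thesis using \<open>k \<noteq> 0\<close> unfolding bd_arc_def by (auto simp: mem_relint)
qed

lemma open_disk: "open (disk j)"
  by (simp add: disk_def)

lemma closure_bd_arc_subset: "closure (bd_arc i j k) \<subseteq> bd i \<inter> cball (c j) (r j)"
proof (rule closure_minimal)
  have "disk j \<subseteq> cball (c j) (r j)" unfolding disk_def by (rule ball_subset_cball)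
  then show "bd_arc i j k \<subseteq> bd i \<inter> cball (c j) (r j)"
    using bd_arc_subset[of i j] by blast
qed (intro closed_Int frontier_closed closed_cball)

lemma disk_subset_Omega: "j \<in> {1..N} \<Longrightarrow> disk j \<subseteq> \<Omega>"
  by (auto simp: \<Omega>_def)

lemma not_ext_bd: "j \<in> {1..N} \<Longrightarrow> x \<in> disk j \<Longrightarrow> x \<notin> ext_bd i"
proof -
  assume "j \<in> {1..N}" "x \<in> disk j"
  moreover have "open \<Omega>" by (auto simp: \<Omega>_def disk_def)
  ultimately show ?thesis using disk_subset_Omega by (auto simp: ext_bd_def frontier_def interior_open)
qed

lemma skel2_subset: "skel2 j i \<subseteq> bd i \<inter> cball (c j) (r j)"
  unfolding skel2_def
proof (rule closure_minimal)
  have "disk j \<subseteq> cball (c j) (r j)" unfolding disk_def by (rule ball_subset_cball)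
  then show "(\<Union>l\<in>nbrs0 j i. bd_arc i j l) \<subseteq> bd i \<inter> cball (c j) (r j)"
    using bd_arc_subset[of i j] by blast
qed (intro closed_Int frontier_closed closed_cball)

text \<open>The sets \<open>bd_arc i j l\<close> omit those points of the arc that are ends of an overlap with a third disk, but
  such a point is a limit of points of the overlap.\<close>

lemma arc_subset_skel2:
  assumes "i \<in> {1..N}" "j \<in> nbrs i"
  shows "bd i \<inter> disk j \<subseteq> skel2 j i"
proof
  fix x assume x: "x \<in> bd i \<inter> disk j"
  let ?A = "\<Union>l\<in>nbrs0 j i. bd_arc i j l"
  have "x \<in> closure ?A"
  proof (cases "x \<in> bd_arc i j 0")
    case True
    then show ?thesis using closure_subset[of ?A] by (auto simp: nbrs0_def)
  next
    case False
    show ?thesis unfolding closure_iff_nhds_not_empty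
    proof (intro allI impI)
      fix B V assume V: "V \<subseteq> B" "open V" "x \<in> V"
      have "open (V \<inter> disk j)" "x \<in> V \<inter> disk j" using V x open_disk by auto
      moreover have "x \<notin> relint i {x \<in> bd i. x \<in> disk j \<and> (\<forall>l\<in>nbrs i - {j}. x \<notin> disk l)}"
        using False by (simp add: bd_arc_def)
      ultimately obtain y l where y: "y \<in> bd i" "y \<in> V" "y \<in> disk j" and l: "l \<in> nbrs i - {j}" "y \<in> disk l"
        using x unfolding mem_relint by blast
      then have "l \<in> nbrs0 j i" "l \<noteq> 0" unfolding nbrs0_def nbrs_def by auto
      moreover have "y \<in> bd_arc i j l" using y l bd_arc_nonzero[OF \<open>l \<noteq> 0\<close>] by auto
      ultimately show "?A \<inter> B \<noteq> {}" using V y by blast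
    qed
  qed
  then show "x \<in> skel2 j i" by (simp add: skel2_def)
qed

lemma skel2_subset_skel: "i \<in> {1..N} \<Longrightarrow> j \<in> nbrs i \<Longrightarrow> skel2 j i \<subseteq> skel j"
  using nbrs_sym by (auto simp: skel_def)

lemma arc_subset_skel_int:
  assumes "i \<in> {1..N}" "j \<in> nbrs i"
  shows "bd i \<inter> disk j \<subseteq> skel_int j"
proof -
  have "disk j \<inter> bd j = {}" using open_disk[of j] by (simp add: frontier_def interior_open) 
  then show ?thesis using arc_subset_skel2[OF assms] nbrs_sym[OF assms] unfolding skel_int_def skel2_int_def by blast
qed

lemma skel_int_eq: "skel_int j = skel j - bd j"
  unfolding skel_int_def skel_def skel2_int_def by blast

lemma skel_subset_cball: "skel i \<subseteq> cball (c i) (r i)"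
  using skel2_subset unfolding skel_def by blast

lemma skel_int_subset_disk: "i \<in> {1..N} \<Longrightarrow> skel_int i \<subseteq> disk i"
  using skel_subset_cball[of i] bd_eq[of i] unfolding skel_int_eq by (auto simp: disk_def)

lemma skel_Int_bd_subset: "skel i \<inter> bd i \<subseteq> (\<Union>j\<in>nbrs i. bd i \<inter> bd j)"
  using skel2_subset unfolding skel_def by blast

lemma finite_skel_Int_bd: "i \<in> {1..N} \<Longrightarrow> finite (skel i \<inter> bd i)"
  by (rule finite_subset[OF skel_Int_bd_subset finite_UN_I[OF finite_nbrs finite_bd_Int]])

lemma closed_skel: "closed (skel i)"
  unfolding skel_def skel2_def by auto

section \<open>Null sets and essential suprema on the skeletons\<close>

lemma AE_arclengthD:
  assumes "AE x in arclength. P x" "k \<in> {1..N}"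
  shows "AE x in arc_measure k. P x"
proof -
  obtain A where A: "{x \<in> space arclength. \<not> P x} \<subseteq> A" "emeasure arclength A = 0" "A \<in> sets arclength"
    using assms(1) by (rule AE_E)
  have "space arclength = UNIV" using sets_eq_imp_space_eq[OF sets_arclength] by simp
  moreover have "A \<in> sets borel" using A(3) sets_arclength by simp
  moreover from this have "emeasure (arc_measure k) A = 0"
    using A(2) emeasure_arclength[of A] assms(2) by (simp add: sum_eq_0_iff)
  ultimately show ?thesis using A(1) by (intro AE_I[of _ _ A]) auto
qed

lemma AE_arclength_not_in_finite: "finite F \<Longrightarrow> AE x in arclength. x \<notin> F"
proof (rule AE_not_in)
  assume F: "finite F"
  then have "emeasure (arc_measure k) F = 0" if "k \<in> {1..N}" for k
    using finite_null_circle_measure[OF radius_pos[OF that] F] by auto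
  moreover have "F \<in> sets borel" using F by (intro borel_closed finite_imp_closed)
  ultimately show "F \<in> null_sets arclength" using emeasure_arclength[of F] sets_arclength by (intro null_setsI) simp_all
qed

lemma AE_skel_measure_iff: "(AE x in skel_measure j. P x) \<longleftrightarrow> (AE x in arclength. x \<in> skel j \<longrightarrow> P x)"
  using closed_skel[of j] sets_arclength sets_eq_imp_space_eq[OF sets_arclength]
  by (intro AE_restrict_space_iff) (simp add: borel_closed)

lemma sup_norm_le_oneD:
  assumes "sup_norm v \<le> 1" "j \<in> {1..N}"
  shows "AE x in arclength. x \<in> skel j \<longrightarrow> \<bar>v j x\<bar> \<le> 1"
proof -
  have "esssup (skel_measure j) (\<lambda>x. ereal \<bar>v j x\<bar>) \<le> sup_norm v"
    unfolding sup_norm_def using assms(2) by (intro Max_ge) auto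
  then have le: "esssup (skel_measure j) (\<lambda>x. ereal \<bar>v j x\<bar>) \<le> 1" using assms(1) by (rule order_trans)
  have "AE x in skel_measure j. \<bar>v j x\<bar> \<le> 1"
    using esssup_AE[of "\<lambda>x. ereal \<bar>v j x\<bar>" "skel_measure j"]
    by eventually_elim (use le in \<open>metis order_trans ereal_less_eq(3) one_ereal_def\<close>)
  then show ?thesis unfolding AE_skel_measure_iff .
qed

lemma skel_int_measurable: "skel_int j \<in> sets borel"
  unfolding skel_int_eq by (intro sets.Diff borel_closed closed_skel frontier_closed)

lemma measurable_skel_measure:
  fixes f :: "complex \<Rightarrow> real"
  assumes "j \<in> {1..N}" "continuous_on (skel_int j) f"
  shows "f \<in> borel_measurable (skel_measure j)"
proof -
  have "(\<lambda>x. indicator (skel j) x * f x) \<in> borel_measurable borel"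
    using assms finite_skel_Int_bd[of j] skel_int_measurable[of j]
    by (intro borel_measurable_continuous_off_finite[of "skel_int j" f "skel j \<inter> bd j"]) (auto simp: skel_int_eq)
  then have "f \<in> borel_measurable (restrict_space borel (skel j))"
    using closed_skel[of j] by (subst borel_measurable_restrict_space_iff) (auto intro: borel_closed)
  then show ?thesis
    using measurable_cong_sets[OF sets_restrict_space_cong[OF sets_arclength, of "skel j"] refl] by blast
qed

lemma esssup_skel_le:
  assumes "j \<in> {1..N}" "continuous_on (skel_int j) f" "\<And>x. x \<in> skel_int j \<Longrightarrow> f x \<le> (b::real)"
  shows "esssup (skel_measure j) (\<lambda>x. ereal (f x)) \<le> ereal b"
proof (rule esssup_I)
  show "(\<lambda>x. ereal (f x)) \<in> borel_measurable (skel_measure j)"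
    using measurable_skel_measure[OF assms(1,2)] by measurable
  show "AE x in skel_measure j. ereal (f x) \<le> ereal b"
    unfolding AE_skel_measure_iff
    using AE_arclength_not_in_finite[OF finite_skel_Int_bd[OF assms(1)]]
    by eventually_elim (use assms(3) in \<open>auto simp: skel_int_eq\<close>)
qed

section \<open>The layers exhaust the disks\<close>

lemma layer_subset: "layer m \<subseteq> {1..N}"
  by (subst layer.simps) (auto simp: boundary_nodes_def)

lemma layer_eq: "1 \<le> m \<Longrightarrow> layer m = boundary_nodes (remaining m)"
  by (subst layer.simps) (simp add: remaining_def)

text \<open>Take a disk that reaches the rightmost point \<open>p\<close> of the union. A second closed disk of the family
  through \<open>p\<close> would have \<open>p\<close> as its rightmost point as well, so one of the two disks would contain the
  other; but the circles of intersecting disks cross. Hence near \<open>p\<close> the circle meets no other closed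
  disk, and it belongs to the frontier of the union.\<close>

lemma boundary_nodes_nonempty:
  assumes W: "W \<subseteq> {1..N}" "W \<noteq> {}"
  shows "boundary_nodes W \<noteq> {}"
proof -
  have finW: "finite W" using W(1) by (rule finite_subset) simp
  define M where "M = Max ((\<lambda>j. Re (c j) + r j) ` W)"
  have "M \<in> (\<lambda>j. Re (c j) + r j) ` W" unfolding M_def using finW W(2) by (intro Max_in) auto
  then obtain i where i: "i \<in> W" "M = Re (c i) + r i" by blast
  have M: "Re (c j) + r j \<le> M" if "j \<in> W" for j unfolding M_def using finW that by (intro Max_ge) auto
  have iN: "i \<in> {1..N}" using i(1) W(1) by blast
  note ri = radius_pos[OF iN]
  define p where "p = c i + of_real (r i)"
  define U where "U = (\<Inter>j\<in>W - {i}. - cball (c j) (r j))"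
  have "open U" unfolding U_def using finW by (intro open_INT) auto
  have "p \<notin> cball (c j) (r j)" if j: "j \<in> W" "j \<noteq> i" for j
  proof
    assume pj: "p \<in> cball (c j) (r j)"
    have jN: "j \<in> {1..N}" using j(1) W(1) by blast
    have "Re (p - c j) \<le> cmod (p - c j)" by (rule complex_Re_le_cmod)
    also have "\<dots> \<le> r j" using pj by (simp add: dist_norm norm_minus_commute)
    finally have 1: "r j \<le> Re (p - c j)" "cmod (p - c j) \<le> r j" "cmod (p - c j) = Re (p - c j)"
      using M[OF j(1)] i(2) complex_Re_le_cmod[of "p - c j"] \<open>cmod (p - c j) \<le> r j\<close> by (auto simp: p_def)
    then have "Re (p - c j) = r j" "Im (p - c j) = 0" using cmod_power2[of "p - c j"] by auto
    then have "p - c j = of_real (r j)" by (simp add: complex_eq_iff)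
    then have cc: "c i - c j = of_real (r j - r i)" by (simp add: p_def algebra_simps)
    then have d: "dist (c i) (c j) = \<bar>r j - r i\<bar>" by (simp add: dist_norm flip: of_real_diff)
    obtain x where "x \<in> disk i \<inter> disk j"
    proof (cases "r i \<le> r j")
      case True
      have "c i \<in> disk i \<inter> disk j" using d True ri radius_pos[OF jN] by (auto simp: disk_def dist_commute)
      then show thesis by (rule that)
    next
      case False
      have "c j \<in> disk i \<inter> disk j" using d False ri radius_pos[OF jN] by (auto simp: disk_def)
      then show thesis by (rule that)
    qed
    then have "j \<in> nbrs i" using j jN by (auto simp: nbrs_def)
    from crossing_nbrs[OF iN this] d show False by (simp add: crossing_def abs_minus_commute)
  qed
  then have pU: "circle_point (c i) (r i) 0 \<in> U" by (auto simp: U_def p_def)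
  have sub: "bd i \<inter> U \<subseteq> frontier (\<Union>l\<in>W. disk l)"
  proof
    fix x assume x: "x \<in> bd i \<inter> U"
    then have "x \<in> closure (disk i)" by (simp add: frontier_def)
    then have "x \<in> closure (\<Union>l\<in>W. disk l)" using i(1) closure_mono[of "disk i" "\<Union>l\<in>W. disk l"] by blast
    moreover have "x \<notin> disk l" if "l \<in> W" for l
    proof (cases "l = i")
      case True then show ?thesis using x open_disk by (simp add: frontier_def interior_open)
    next
      case False then show ?thesis using x that ball_subset_cball unfolding U_def disk_def by blast
    qed
    moreover have "open (\<Union>l\<in>W. disk l)" using open_disk by blast
    ultimately show "x \<in> frontier (\<Union>l\<in>W. disk l)" by (simp add: frontier_def interior_open)
  qed
  from topological_tendstoD[OF circle_point_tendsto \<open>open U\<close> pU, of 1]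
  obtain \<delta> where \<delta>: "0 < \<delta>" "\<And>t. 0 < t \<Longrightarrow> t < \<delta> \<Longrightarrow> circle_point (c i) (r i) t \<in> U"
    unfolding eventually_at_right_field by auto
  have "ennreal (r i * min \<delta> 1 / 2) \<le> emeasure (arc_measure i) (bd i \<inter> frontier (\<Union>l\<in>W. disk l))"
  proof (rule emeasure_circle_measure_ge[OF ri, where \<theta> = 0])
    fix t assume "0 < t" "t < 0 + min \<delta> 1"
    then show "circle_point (c i) (r i) t \<in> bd i \<inter> frontier (\<Union>l\<in>W. disk l)"
      using \<delta>(2)[of t] sub circle_point_in_sphere[OF ri] bd_eq[OF iN] by auto
  qed (use \<delta>(1) pi_gt3 in \<open>auto intro!: borel_closed closed_Int frontier_closed\<close>)
  moreover have "0 < ennreal (r i * min \<delta> 1 / 2)" using ri \<delta>(1) by simp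
  ultimately have "0 < emeasure (arc_measure i) (bd i \<inter> frontier (\<Union>l\<in>W. disk l))" by (rule less_le_trans[rotated])
  then show ?thesis using i(1) unfolding boundary_nodes_def by blast
qed

lemma remaining_Suc: "1 \<le> m \<Longrightarrow> remaining (Suc m) = remaining m - layer m"
  unfolding remaining_def by (auto simp: less_Suc_eq)

text \<open>Each layer removes at least one disk, so \<open>remaining m\<close> is empty from some \<open>m\<close> on, and the least such \<open>m\<close>
  is \<open>N_max + 1\<close>.\<close>

lemma Union_layers: "(\<Union>k\<in>{1..N_max}. layer k) = {1..N}"
proof -
  have fin: "finite (remaining m)" for m by (simp add: remaining_def)
  have dec: "card (remaining (Suc m)) < card (remaining m)" if "1 \<le> m" "remaining m \<noteq> {}" for m
  proof -
    have "remaining m \<subseteq> {1..N}" unfolding remaining_def by blast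
    then have "layer m \<noteq> {}"
      unfolding layer_eq[OF that(1)] using that(2) by (rule boundary_nodes_nonempty)
    moreover have "layer m \<subseteq> remaining m"
      unfolding layer_eq[OF that(1)] boundary_nodes_def by blast
    ultimately show ?thesis unfolding remaining_Suc[OF that(1)] by (intro psubset_card_mono fin) blast
  qed
  have anti: "remaining n \<subseteq> remaining m" if "m \<le> n" for m n using that unfolding remaining_def by auto
  have "\<exists>m\<ge>1. remaining m = {}"
  proof (rule ccontr)
    assume "\<not> (\<exists>m\<ge>1. remaining m = {})"
    then have "card (remaining (Suc m)) + m \<le> N" for m
    proof (induction m)
      case 0 show ?case by (simp add: remaining_def)
    next
      case (Suc m)
      then have "card (remaining (Suc (Suc m))) < card (remaining (Suc m))" by (intro dec) auto
      then show ?case using Suc by simp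
    qed
    from this[of "Suc N"] show False by simp
  qed
  define m where "m = (LEAST m. 1 \<le> m \<and> remaining m = {})"
  have m: "1 \<le> m" "remaining m = {}"
    using LeastI_ex[OF \<open>\<exists>m\<ge>1. remaining m = {}\<close>] by (auto simp: m_def)
  have "{k. 1 \<le> k \<and> remaining k \<noteq> {}} = {1..<m}"
  proof (intro set_eqI iffI)
    fix k assume "k \<in> {k. 1 \<le> k \<and> remaining k \<noteq> {}}"
    then show "k \<in> {1..<m}" using anti[of m k] m(2) by (cases "m \<le> k") auto
  next
    fix k assume "k \<in> {1..<m}"
    then show "k \<in> {k. 1 \<le> k \<and> remaining k \<noteq> {}}" using not_less_Least[of k "\<lambda>m. 1 \<le> m \<and> remaining m = {}"]
      by (auto simp: m_def)
  qed
  then have "N_max = m - 1" by (simp add: N_max_def)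
  then have "{1..N_max} = {1..<m}" using m(1) by auto
  then show ?thesis using m(2) layer_subset unfolding remaining_def by auto
qed

end

section \<open>The partition of unity and the boundary datum\<close>

locale disks_with_partition = admissible_disks +
  fixes chi :: "nat \<Rightarrow> nat \<Rightarrow> complex \<Rightarrow> real"
  assumes partition: "partition_of_unity chi"
begin

lemmas partition_at = bspec[OF partition[unfolded partition_of_unity_def]]
lemmas partition_nbr = bspec[OF conjunct1[OF partition_at]]

lemma chi_continuous: "i \<in> {1..N} \<Longrightarrow> j \<in> nbrs i \<Longrightarrow> continuous_on (relint i (int_bd i)) (chi i j)"
  by (drule (1) partition_nbr) (elim conjE)

lemma chi_one: "i \<in> {1..N} \<Longrightarrow> j \<in> nbrs i \<Longrightarrow> x \<in> closure (bd_arc i j 0) - ext_bd i \<Longrightarrow> chi i j x = 1"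
  by (drule (1) partition_nbr) (elim conjE, rule bspec)

lemma chi_unit: "i \<in> {1..N} \<Longrightarrow> j \<in> nbrs i \<Longrightarrow> k \<in> nbrs0 i j - {0} \<Longrightarrow>
    x \<in> closure (bd_arc i j k) - ext_bd i \<Longrightarrow> 0 \<le> chi i j x \<and> chi i j x \<le> 1"
  by (drule (1) partition_nbr) (elim conjE, drule (1) bspec, erule bspec)

lemma chi_zero: "i \<in> {1..N} \<Longrightarrow> j \<in> nbrs i \<Longrightarrow> x \<in> bd i \<Longrightarrow>
    x \<notin> (\<Union>k\<in>nbrs0 i j. closure (bd_arc i j k) - ext_bd i) \<Longrightarrow> \<not> (x isolated_in ext_bd i) \<Longrightarrow> chi i j x = 0"
  by (drule (1) partition_nbr) (elim conjE, drule (1) bspec, erule mp, rule conjI)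

lemma chi_sum: "i \<in> {1..N} \<Longrightarrow> x \<in> relint i (int_bd i) \<Longrightarrow> (\<Sum>k\<in>nbrs i. chi i k x) = 1"
  by (drule partition_at) (elim conjE, erule bspec)

lemma chi_zero_off_arc:
  assumes "i \<in> {1..N}" "j \<in> nbrs i" "x \<in> bd i" "x \<notin> cball (c j) (r j)" "x \<notin> ext_bd i"
  shows "chi i j x = 0"
proof (rule chi_zero[OF assms(1-3)])
  show "x \<notin> (\<Union>k\<in>nbrs0 i j. closure (bd_arc i j k) - ext_bd i)"
    using closure_bd_arc_subset assms(4) by blast
  show "\<not> (x isolated_in ext_bd i)" using assms(5) by (simp add: isolated_in_def)
qed

lemma chi_unit_on_arc:
  assumes "i \<in> {1..N}" "j \<in> nbrs i" "x \<in> bd i" "k \<in> {1..N}" "x \<in> disk k"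
  shows "0 \<le> chi i j x" "chi i j x \<le> 1"
proof -
  have ext: "x \<notin> ext_bd i" using not_ext_bd assms by blast
  then have "\<not> (x isolated_in ext_bd i)" by (simp add: isolated_in_def)
  then consider k where "k \<in> nbrs0 i j" "x \<in> closure (bd_arc i j k) - ext_bd i" | "chi i j x = 0"
    using chi_zero[OF assms(1-3)] by blast
  then have "0 \<le> chi i j x \<and> chi i j x \<le> 1"
  proof cases
    case (1 k) then show ?thesis using chi_one[OF assms(1,2)] chi_unit[OF assms(1,2), of k] by (cases "k = 0") auto
  qed auto
  then show "0 \<le> chi i j x" "chi i j x \<le> 1" by auto
qed

lemma arc_subset_relint:
  assumes "j \<in> {1..N}" shows "bd i \<inter> disk j \<subseteq> relint i (int_bd i)"
proof -
  have "bd i \<inter> disk j \<subseteq> int_bd i"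
    using not_ext_bd[OF assms] closure_subset[of "bd i - ext_bd i"] unfolding int_bd_def by blast
  then show ?thesis unfolding mem_relint subset_eq using open_disk[of j] by (metis IntE)
qed

text \<open>The common boundary function of the Poisson integrals that make up the component \<open>i\<close> of \<open>T_op\<close>,
  see \<open>T_op_eq_poisson_integral\<close>.\<close>

definition datum :: "(nat \<Rightarrow> complex \<Rightarrow> real) \<Rightarrow> nat \<Rightarrow> complex \<Rightarrow> real" where
  "datum u i y = (\<Sum>j\<in>nbrs i. indicator (skel2 j i) y * (u j y * chi i j y))"

text \<open>At a point that lies on no circle of a neighbour, only the disks containing it contribute; their weights are
  nonnegative and sum to 1 unless there are none. The latter case is the reason for \<open>0 \<le> b\<close>.\<close>

lemma datum_le:
  assumes i: "i \<in> {1..N}" and y: "y \<in> bd i"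
    and sep: "\<And>j. j \<in> nbrs i \<Longrightarrow> y \<in> disk j \<or> y \<notin> cball (c j) (r j)"
    and u: "\<And>j. j \<in> nbrs i \<Longrightarrow> y \<in> disk j \<Longrightarrow> u j y \<le> b" and b: "0 \<le> b"
  shows "datum u i y \<le> b"
proof (cases "\<exists>k\<in>nbrs i. y \<in> disk k")
  case False
  then have "y \<notin> skel2 j i" if "j \<in> nbrs i" for j
    using sep[OF that] skel2_subset[of j i] that by blast
  then show ?thesis using b by (simp add: datum_def)
next
  case True
  then obtain k where k: "k \<in> nbrs i" "y \<in> disk k" ..
  note kN = nbrs_in[OF k(1)]
  have "indicator (skel2 j i) y * (u j y * chi i j y) \<le> b * chi i j y" if j: "j \<in> nbrs i" for j
  proof (cases "y \<in> disk j")
    case True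
    then have "y \<in> skel2 j i" using arc_subset_skel2[OF i j] y by blast
    then show ?thesis using mult_right_mono[OF u[OF j True] chi_unit_on_arc(1)[OF i j y kN k(2)]] by simp
  next
    case False
    then have cb: "y \<notin> cball (c j) (r j)" using sep[OF j] by blast
    then have "y \<notin> skel2 j i" using skel2_subset[of j i] by blast
    moreover have "chi i j y = 0" using chi_zero_off_arc[OF i j y cb not_ext_bd[OF kN k(2)]] .
    ultimately show ?thesis by simp
  qed
  then have "datum u i y \<le> (\<Sum>j\<in>nbrs i. b * chi i j y)"
    unfolding datum_def by (intro sum_mono)
  also have "\<dots> = b"
    using chi_sum[OF i, of y] arc_subset_relint[OF kN, of i] y k(2) by (simp flip: sum_distrib_left) blast
  finally show ?thesis .
qed

text \<open>Otherwise the point is isolated in the exterior boundary, so it belongs to the relative interior of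
  \<open>int_bd i\<close>, where the weights are continuous with sum 1. A disk that does not contain the point misses
  one of its two sides. Its weight vanishes on that side, hence at the point by continuity, and this
  applies to all disks.\<close>

lemma no_isolated_ext_bd:
  assumes i: "i \<in> {1..N}"
    and k: "k \<in> nbrs i" and k_in: "\<forall>\<^sub>F t in at_right 0. circle_point (c i) (r i) (\<theta> - t) \<in> disk k"
    and l: "l \<in> nbrs i" and l_in: "\<forall>\<^sub>F t in at_right 0. circle_point (c i) (r i) (\<theta> + t) \<in> disk l"
  shows "\<exists>m\<in>nbrs i. circle_point (c i) (r i) \<theta> \<in> disk m"
proof (rule ccontr)
  assume none: "\<not> (\<exists>m\<in>nbrs i. circle_point (c i) (r i) \<theta> \<in> disk m)"
  let ?p = "\<lambda>t. circle_point (c i) (r i) t"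
  define x where "x = ?p \<theta>"
  note ri = radius_pos[OF i]
  have bd: "?p t \<in> bd i" for t using circle_point_in_sphere[OF ri] unfolding bd_eq[OF i] .
  obtain \<delta> where \<delta>: "0 < \<delta>" "\<And>t. 0 < t \<Longrightarrow> t < \<delta> \<Longrightarrow> ?p (\<theta> - t) \<in> disk k \<and> ?p (\<theta> + t) \<in> disk l"
    using eventually_conj[OF k_in l_in] unfolding eventually_at_right_field by blast
  define \<epsilon> where "\<epsilon> = min \<delta> pi"
  have \<epsilon>: "0 < \<epsilon>" "\<epsilon> \<le> pi" "\<epsilon> \<le> \<delta>" using \<delta>(1) by (auto simp: \<epsilon>_def)
  have sin_pos: "0 < sin (\<epsilon> / 2)" using \<epsilon> by (intro sin_gt_zero) auto
  \<comment> \<open>\<open>2 r sin (\<epsilon> / 2)\<close> is the chord of the angle \<open>\<epsilon>\<close>.\<close>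
  define U where "U = ball x (2 * r i * sin (\<epsilon> / 2))"
  have near: "y \<in> disk k \<union> disk l" if y: "y \<in> bd i" "y \<in> U" "y \<noteq> x" for y
  proof -
    obtain t where t: "0 \<le> t" "t < 2 * pi" "y = ?p (\<theta> + t)"
      using y(1) sphere_circle_pointE[OF ri] unfolding bd_eq[OF i] by blast
    have "t \<noteq> 0" using y(3) t(3) by (auto simp: x_def)
    have "dist y x = 2 * r i * sin (t / 2)"
      unfolding t(3) x_def dist_circle_point[OF ri] using t sin_ge_zero[of "t / 2"] by simp
    then have "sin (t / 2) < sin (\<epsilon> / 2)" using y(2) ri by (simp add: U_def dist_commute)
    then consider "t < \<epsilon>" | "2 * pi - \<epsilon> < t"
      using sin_monotone_2pi_le[of "\<epsilon> / 2" "t / 2"] sin_monotone_2pi_le[of "\<epsilon> / 2" "pi - t / 2"] \<epsilon> t(1,2)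
      by (cases "t \<le> pi") force+
    then show ?thesis
    proof cases
      case 1 then show ?thesis using \<delta>(2)[of t] t \<open>t \<noteq> 0\<close> \<epsilon> by simp
    next
      case 2
      have "\<theta> + t = \<theta> - (2 * pi - t) + 2 * pi * of_int 1" by simp
      then have "y = ?p (\<theta> - (2 * pi - t))" unfolding t(3) by (simp only: circle_point_add_2pi)
      then show ?thesis using \<delta>(2)[of "2 * pi - t"] t(2) 2 \<epsilon> by auto
    qed
  qed
  have xU: "x \<in> U" using sin_pos ri by (simp add: U_def)
  note kl_not_ext = not_ext_bd[OF nbrs_in[OF k]] not_ext_bd[OF nbrs_in[OF l]]
  have lim: "((\<lambda>t. ?p (\<theta> + \<sigma> * t)) \<longlongrightarrow> x) (at_right 0)" for \<sigma>
    unfolding x_def by (rule circle_point_tendsto)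
  have sides: "\<forall>\<^sub>F t in at_right 0. ?p (\<theta> + \<sigma> * t) \<in> disk k \<union> disk l" if "\<sigma> = 1 \<or> \<sigma> = -1" for \<sigma>
    using that
  proof
    assume "\<sigma> = 1" then show ?thesis by (intro eventually_mono[OF l_in]) simp
  next
    assume "\<sigma> = -1" then show ?thesis by (intro eventually_mono[OF k_in]) simp
  qed
  have "x \<in> closure (bd i - ext_bd i)"
  proof (rule Lim_in_closed_set[OF closed_closure _ _ lim[of 1]])
    show "\<forall>\<^sub>F t in at_right 0. ?p (\<theta> + 1 * t) \<in> closure (bd i - ext_bd i)"
      using sides[OF disjI1[OF refl]]
    proof eventually_elim
      case (elim t)
      then have "?p (\<theta> + 1 * t) \<in> bd i - ext_bd i" using kl_not_ext bd by blast
      then show ?case by (rule subsetD[OF closure_subset])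
    qed
  qed simp
  moreover have "y \<in> int_bd i" if "y \<in> bd i \<inter> U" "y \<noteq> x" for y
    using near[of y] that kl_not_ext closure_subset[of "bd i - ext_bd i"] unfolding int_bd_def by blast
  ultimately have "bd i \<inter> U \<subseteq> int_bd i" unfolding int_bd_def by blast
  then have x: "x \<in> relint i (int_bd i)"
    unfolding mem_relint using xU bd[of \<theta>] open_ball unfolding U_def x_def by blast
  have "chi i m x = 0" if m: "m \<in> nbrs i" for m
  proof -
    have "x \<notin> ball (c m) (r m)" using none m unfolding x_def disk_def by blast
    then obtain \<sigma> where \<sigma>: "\<sigma> = 1 \<or> \<sigma> = -1"
      and out: "\<forall>\<^sub>F t in at_right 0. ?p (\<theta> + \<sigma> * t) \<notin> cball (c m) (r m)"
      using arc_germ_outside[OF crossing_nbrs[OF i m]] unfolding x_def by blast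
    have "\<forall>\<^sub>F t in at_right 0. chi i m (?p (\<theta> + \<sigma> * t)) = 0"
      using out sides[OF \<sigma>]
    proof eventually_elim
      case (elim t)
      then show ?case using chi_zero_off_arc[OF i m bd elim(1)] kl_not_ext by blast
    qed
    then have 0: "((\<lambda>t. chi i m (?p (\<theta> + \<sigma> * t))) \<longlongrightarrow> 0) (at_right 0)"
      by (rule tendsto_eventually)
    have "((\<lambda>t. chi i m (?p (\<theta> + \<sigma> * t))) \<longlongrightarrow> chi i m x) (at_right 0)"
    proof (rule continuous_on_tendsto_compose[OF chi_continuous[OF i m] lim x])
      show "\<forall>\<^sub>F t in at_right 0. ?p (\<theta> + \<sigma> * t) \<in> relint i (int_bd i)"
        using sides[OF \<sigma>]
        by eventually_elim (use arc_subset_relint[OF nbrs_in[OF k]] arc_subset_relint[OF nbrs_in[OF l]] bd in blast)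
    qed
    from tendsto_unique[OF _ this 0] show ?thesis by simp
  qed
  then show False using chi_sum[OF i x] by simp
qed

text \<open>The bound holds on the side outside disk \<open>k\<close>. The disks that cover this side contain the crossing point
  itself, so that the values of \<open>u\<close> are controlled by continuity there. For if a disk \<open>l\<close> covered this side but
  not the point, it would abut disk \<open>k\<close>; then some disk \<open>m\<close> contains the point by \<open>no_isolated_ext_bd\<close>, and
  no part of circle \<open>i\<close> is left to disk \<open>m\<close> alone by \<open>arc_subset_neighbouring_arcs\<close>.\<close>

lemma one_sided_bound:
  assumes i: "i \<in> {1..N}" and k: "k \<in> nbrs i" and xk: "circle_point (c i) (r i) \<theta> \<in> bd k"
    and cont: "\<And>j. j \<in> {1..N} \<Longrightarrow> continuous_on (skel_int j) (u j)"
    and less: "\<And>j x. j \<in> {1..N} \<Longrightarrow> x \<in> skel_int j \<Longrightarrow> u j x < 1"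
  shows "\<exists>\<sigma> b. (\<sigma> = 1 \<or> \<sigma> = -1) \<and> b < 1 \<and>
    (\<forall>\<^sub>F t in at_right 0. datum u i (circle_point (c i) (r i) (\<theta> + \<sigma> * t)) \<le> b)"
proof -
  let ?p = "\<lambda>t. circle_point (c i) (r i) t"
  note ri = radius_pos[OF i]
  have bd: "?p t \<in> bd i" for t using circle_point_in_sphere[OF ri] unfolding bd_eq[OF i] .
  have sphere_k: "?p \<theta> \<in> sphere (c k) (r k)" using xk unfolding bd_eq[OF nbrs_in[OF k]] .
  obtain \<sigma>k Lk where \<sigma>k: "\<sigma>k = 1 \<or> \<sigma>k = -1" and Lk: "0 < Lk" "Lk < 2 * pi"
    and in_k: "\<forall>t\<in>{0<..<2 * pi}. ?p (\<theta> + \<sigma>k * t) \<in> ball (c k) (r k) \<longleftrightarrow> t < Lk"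
    and out_k: "\<forall>\<^sub>F t in at_right 0. ?p (\<theta> - \<sigma>k * t) \<notin> cball (c k) (r k)"
    by (rule arc_from_endpoint[OF crossing_nbrs[OF i k] sphere_k])
  define \<sigma> where "\<sigma> = - \<sigma>k"
  have \<sigma>: "\<sigma> = 1 \<or> \<sigma> = -1" using \<sigma>k by (auto simp: \<sigma>_def)
  \<comment> \<open>the disks that cover the chosen side; the direction \<open>\<sigma>\<close> leads away from disk \<open>k\<close>\<close>
  define B where "B = {l \<in> nbrs i. \<forall>\<^sub>F t in at_right 0. ?p (\<theta> + \<sigma> * t) \<in> disk l}"
  have "finite B" by (simp add: B_def)
  have out: "\<forall>\<^sub>F t in at_right 0. ?p (\<theta> + \<sigma> * t) \<notin> cball (c l) (r l)" if "l \<in> nbrs i - B" for l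
    using arc_germ[OF crossing_nbrs[OF i] \<sigma>, of l \<theta>] that unfolding B_def disk_def by blast
  have inside: "?p \<theta> \<in> disk l" if l: "l \<in> B" for l
  proof (rule ccontr)
    assume nl: "?p \<theta> \<notin> disk l"
    have lB: "l \<in> nbrs i" "\<forall>\<^sub>F t in at_right 0. ?p (\<theta> + \<sigma> * t) \<in> disk l" using l by (auto simp: B_def)
    have k_germ: "\<forall>\<^sub>F t in at_right 0. ?p (\<theta> - \<sigma> * t) \<in> disk k"
      using eventually_at_right_real[OF Lk(1)] by eventually_elim (use in_k Lk in \<open>auto simp: disk_def \<sigma>_def\<close>)
    have "\<exists>m\<in>nbrs i. ?p \<theta> \<in> disk m"
    proof (cases "\<sigma> = 1")
      case True
      then show ?thesis using no_isolated_ext_bd[OF i k _ lB(1), of \<theta>] k_germ lB(2) by simp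
    next
      case False
      then have "\<sigma> = -1" using \<sigma> by simp
      then show ?thesis using no_isolated_ext_bd[OF i lB(1) _ k, of \<theta>] k_germ lB(2) by simp
    qed
    then obtain m where m: "m \<in> nbrs i" "?p \<theta> \<in> disk m" ..
    have "?p \<theta> \<in> cball (c l) (r l)"
    proof (rule Lim_in_closed_set[OF closed_cball _ _ circle_point_tendsto])
      show "\<forall>\<^sub>F t in at_right 0. ?p (\<theta> + \<sigma> * t) \<in> cball (c l) (r l)"
        using lB(2) by eventually_elim (auto simp: disk_def)
    qed simp
    then have sphere_l: "?p \<theta> \<in> sphere (c l) (r l)" using nl by (auto simp: disk_def)
    obtain \<sigma>l Ll where \<sigma>l: "\<sigma>l = 1 \<or> \<sigma>l = -1" and Ll: "0 < Ll" "Ll < 2 * pi"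
      and in_l: "\<forall>t\<in>{0<..<2 * pi}. ?p (\<theta> + \<sigma>l * t) \<in> ball (c l) (r l) \<longleftrightarrow> t < Ll"
      and out_l: "\<forall>\<^sub>F t in at_right 0. ?p (\<theta> - \<sigma>l * t) \<notin> cball (c l) (r l)"
      by (rule arc_from_endpoint[OF crossing_nbrs[OF i lB(1)] sphere_l])
    have bal: "?p \<theta> \<notin> ball (c l) (r l)" "?p \<theta> \<notin> ball (c k) (r k)" using sphere_l sphere_k by auto
    have not_out: "\<not> (\<forall>\<^sub>F t in at_right 0. ?p (\<theta> + \<sigma> * t) \<notin> cball (c l) (r l))"
    proof
      assume "\<forall>\<^sub>F t in at_right 0. ?p (\<theta> + \<sigma> * t) \<notin> cball (c l) (r l)"
      with lB(2) have "\<forall>\<^sub>F t in at_right (0::real). False"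
        by eventually_elim (use ball_subset_cball in \<open>auto simp: disk_def\<close>)
      then show False by simp
    qed
    have eqs: "\<sigma>l = \<sigma>"
    proof (rule ccontr)
      assume "\<sigma>l \<noteq> \<sigma>"
      then have "\<sigma>l = - \<sigma>" using \<sigma> \<sigma>l by auto
      with out_l not_out show False by simp
    qed
    have ne: "k \<noteq> m" "l \<noteq> m" "k \<noteq> l"
      using m(2) bal not_out out_k unfolding disk_def \<sigma>_def by auto
    have m': "?p \<theta> \<in> ball (c m) (r m)" using m(2) by (simp add: disk_def)
    have nk: "\<not> sphere (c i) (r i) \<inter> ball (c k) (r k) \<subseteq> ball (c m) (r m)"
      and nl: "\<not> sphere (c i) (r i) \<inter> ball (c l) (r l) \<subseteq> ball (c m) (r m)"
      using arc_not_subset[OF i k m(1)] arc_not_subset[OF i lB(1) m(1)] ne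
      unfolding bd_eq[OF i] unfolding disk_def by blast+
    \<comment> \<open>Depending on \<open>\<sigma>\<close>, the arc of disk \<open>k\<close> or that of disk \<open>l\<close> lies in negative direction.\<close>
    have cover: "sphere (c i) (r i) \<inter> ball (c m) (r m) \<subseteq> ball (c k) (r k) \<union> ball (c l) (r l) \<union> {?p \<theta>}"
    proof (cases "\<sigma> = 1")
      case True
      show ?thesis
      proof (rule arc_subset_neighbouring_arcs[OF crossing_nbrs[OF i m(1)] m' Lk(2) bal(2) nk _ Ll(2) bal(1) nl])
        show "0 < t \<Longrightarrow> t < 2 * pi \<Longrightarrow> ?p (\<theta> - t) \<in> ball (c k) (r k) \<longleftrightarrow> t < Lk" for t
          using bspec[OF in_k, of t] True by (simp add: \<sigma>_def)
        show "0 < t \<Longrightarrow> t < 2 * pi \<Longrightarrow> ?p (\<theta> + t) \<in> ball (c l) (r l) \<longleftrightarrow> t < Ll" for t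
          using bspec[OF in_l, of t] True by (simp add: eqs)
      qed
    next
      case False
      then have s: "\<sigma> = -1" using \<sigma> by simp
      have "sphere (c i) (r i) \<inter> ball (c m) (r m) \<subseteq> ball (c l) (r l) \<union> ball (c k) (r k) \<union> {?p \<theta>}"
      proof (rule arc_subset_neighbouring_arcs[OF crossing_nbrs[OF i m(1)] m' Ll(2) bal(1) nl _ Lk(2) bal(2) nk])
        show "0 < t \<Longrightarrow> t < 2 * pi \<Longrightarrow> ?p (\<theta> - t) \<in> ball (c l) (r l) \<longleftrightarrow> t < Ll" for t
          using bspec[OF in_l, of t] s by (simp add: eqs)
        show "0 < t \<Longrightarrow> t < 2 * pi \<Longrightarrow> ?p (\<theta> + t) \<in> ball (c k) (r k) \<longleftrightarrow> t < Lk" for t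
          using bspec[OF in_k, of t] s by (simp add: \<sigma>_def)
      qed
      then show ?thesis by blast
    qed
    obtain G where G: "G \<in> sets borel" "G \<subseteq> bd i \<inter> disk m" "emeasure (arc_measure i) G > 0"
      "\<forall>k\<in>{1..N} - {i, m}. G \<inter> disk k = {}" by (rule private_arcE[OF i m(1)])
    have "k \<in> {1..N} - {i, m}" "l \<in> {1..N} - {i, m}" using k lB(1) ne by (auto simp: nbrs_def)
    then have "G \<inter> disk k = {}" "G \<inter> disk l = {}" using G(4) by blast+
    then have "G \<subseteq> {?p \<theta>}" using G(2) cover unfolding bd_eq[OF i] unfolding disk_def by blast
    moreover have "emeasure (arc_measure i) {?p \<theta>} = 0"
      using AE_circle_measure_neq[OF ri, where a = "c i" and z = "?p \<theta>"]
      by (subst (asm) AE_iff_measurable[OF _ refl]) simp_all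
    ultimately show False using G(3) emeasure_mono[of G "{?p \<theta>}" "arc_measure i"] by simp
  qed
  \<comment> \<open>The midpoint of 1 and the largest value leaves room for continuity; 0 is included for \<open>B = {}\<close>.\<close>
  obtain b where b: "0 \<le> b" "b < 1" "\<And>l. l \<in> B \<Longrightarrow> u l (?p \<theta>) < b"
  proof -
    let ?m = "Max (insert 0 ((\<lambda>l. u l (?p \<theta>)) ` B))"
    have "u l (?p \<theta>) < 1" if "l \<in> B" for l
      using less[of l "?p \<theta>"] arc_subset_skel_int[OF i, of l] inside[OF that] bd that nbrs_in[of l i] unfolding B_def by blast
    then have "?m < 1" using \<open>finite B\<close> by (subst Max_less_iff) auto
    moreover have "0 \<le> ?m" using \<open>finite B\<close> by (intro Max_ge) auto
    moreover have "u l (?p \<theta>) \<le> ?m" if "l \<in> B" for l using \<open>finite B\<close> that by (intro Max_ge) auto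
    ultimately show thesis by (intro that[of "(?m + 1) / 2"]) fastforce+
  qed
  have ub: "\<forall>\<^sub>F t in at_right 0. u l (?p (\<theta> + \<sigma> * t)) \<le> b" if l: "l \<in> B" for l
  proof -
    have lB: "l \<in> nbrs i" "\<forall>\<^sub>F t in at_right 0. ?p (\<theta> + \<sigma> * t) \<in> disk l" using l by (auto simp: B_def)
    note sub = arc_subset_skel_int[OF i lB(1)]
    have "((\<lambda>t. u l (?p (\<theta> + \<sigma> * t))) \<longlongrightarrow> u l (?p \<theta>)) (at_right 0)"
    proof (rule continuous_on_tendsto_compose[OF cont[OF nbrs_in[OF lB(1)]] circle_point_tendsto])
      show "?p \<theta> \<in> skel_int l" using inside[OF l] bd sub by blast
      show "\<forall>\<^sub>F t in at_right 0. ?p (\<theta> + \<sigma> * t) \<in> skel_int l"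
        using lB(2) by eventually_elim (use bd sub in blast)
    qed
    from order_tendstoD(2)[OF this b(3)[OF l]] show ?thesis by eventually_elim simp
  qed
  have "\<forall>\<^sub>F t in at_right 0. \<forall>l\<in>nbrs i.
      (l \<in> B \<and> ?p (\<theta> + \<sigma> * t) \<in> disk l \<and> u l (?p (\<theta> + \<sigma> * t)) \<le> b) \<or> ?p (\<theta> + \<sigma> * t) \<notin> cball (c l) (r l)"
  proof (rule eventually_ball_finite[OF finite_nbrs], rule ballI)
    fix l assume l: "l \<in> nbrs i"
    show "\<forall>\<^sub>F t in at_right 0. (l \<in> B \<and> ?p (\<theta> + \<sigma> * t) \<in> disk l \<and> u l (?p (\<theta> + \<sigma> * t)) \<le> b)
        \<or> ?p (\<theta> + \<sigma> * t) \<notin> cball (c l) (r l)"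
    proof (cases "l \<in> B")
      case True
      then have "\<forall>\<^sub>F t in at_right 0. ?p (\<theta> + \<sigma> * t) \<in> disk l" by (simp add: B_def)
      with ub[OF True] show ?thesis by eventually_elim (use True in blast)
    next
      case False
      from out[of l] l False show ?thesis by (auto elim: eventually_mono)
    qed
  qed
  then have "\<forall>\<^sub>F t in at_right 0. datum u i (?p (\<theta> + \<sigma> * t)) \<le> b"
  proof eventually_elim
    case (elim t)
    show ?case
    proof (rule datum_le[OF i bd _ _ b(1)])
      fix j assume j: "j \<in> nbrs i"
      show "?p (\<theta> + \<sigma> * t) \<in> disk j \<or> ?p (\<theta> + \<sigma> * t) \<notin> cball (c j) (r j)" using bspec[OF elim j] by blast
      have "disk j \<subseteq> cball (c j) (r j)" unfolding disk_def by (rule ball_subset_cball)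
      then show "u j (?p (\<theta> + \<sigma> * t)) \<le> b" if "?p (\<theta> + \<sigma> * t) \<in> disk j"
        using bspec[OF elim j] that by blast
    qed
  qed
  with \<sigma> b(2) show ?thesis by blast
qed

end

section \<open>Strict bounds for the iteration operator\<close>

lemma finite_uniform_bound:
  fixes f :: "'a \<Rightarrow> real"
  assumes "finite I" "\<And>z. z \<in> I \<Longrightarrow> \<exists>b<1. \<forall>x. Q z x \<longrightarrow> f x \<le> b"
  shows "\<exists>b<1. \<forall>z\<in>I. \<forall>x. Q z x \<longrightarrow> f x \<le> b"
  using assms
proof (induction I rule: finite_induct)
  case empty
  show ?case by (intro exI[of _ 0]) simp
next
  case (insert w I)
  then obtain b where b: "b < 1" "\<forall>z\<in>I. \<forall>x. Q z x \<longrightarrow> f x \<le> b" by blast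
  obtain b' where b': "b' < 1" "\<forall>x. Q w x \<longrightarrow> f x \<le> b'" using insert.prems by blast
  show ?case using b b' by (intro exI[of _ "max b b'"]) (fastforce simp: le_max_iff_disj)
qed

context disks_with_partition
begin

context
  fixes u :: "nat \<Rightarrow> complex \<Rightarrow> real" and i :: nat
  assumes i: "i \<in> {1..N}"
    and cont: "\<And>j. j \<in> {1..N} \<Longrightarrow> continuous_on (skel_int j) (u j)"
    and bounded: "\<And>j. j \<in> {1..N} \<Longrightarrow> AE x in arclength. x \<in> skel j \<longrightarrow> \<bar>u j x\<bar> \<le> 1"
begin

lemma datum_term_measurable:
  assumes j: "j \<in> nbrs i"
  shows "(\<lambda>y. indicator (skel2 j i) y * (u j y * chi i j y)) \<in> borel_measurable borel"
proof (rule borel_measurable_continuous_off_finite)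
  show "bd i \<inter> disk j \<in> sets borel"
    using open_disk by (intro sets.Int borel_closed borel_open frontier_closed)
  show "continuous_on (bd i \<inter> disk j) (\<lambda>y. u j y * chi i j y)"
    by (intro continuous_on_mult continuous_on_subset[OF cont[OF nbrs_in[OF j]] arc_subset_skel_int[OF i j]]
      continuous_on_subset[OF chi_continuous[OF i j] arc_subset_relint[OF nbrs_in[OF j]]])
  show "finite (bd i \<inter> bd j)" by (rule finite_bd_Int[OF i j])
  show "skel2 j i - bd i \<inter> bd j \<subseteq> bd i \<inter> disk j"
    using skel2_subset[of j i] bd_eq[OF nbrs_in[OF j]] by (auto simp: disk_def)
  show "bd i \<inter> disk j \<subseteq> skel2 j i" by (rule arc_subset_skel2[OF i j])
qed

lemma AE_regular_boundary_point:
  "AE y in arc_measure i. y \<in> bd i \<and> (\<forall>j\<in>nbrs i. (y \<in> disk j \<or> y \<notin> cball (c j) (r j)) \<and> (y \<in> skel2 j i \<longrightarrow> \<bar>u j y\<bar> \<le> 1))"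
proof -
  have "AE y in arc_measure i. \<forall>j\<in>nbrs i. y \<notin> bd i \<inter> bd j"
  proof (intro AE_finite_allI finite_nbrs)
    fix j assume "j \<in> nbrs i"
    then show "AE y in arc_measure i. y \<notin> bd i \<inter> bd j"
      by (intro AE_not_in finite_null_circle_measure radius_pos i finite_bd_Int)
  qed
  moreover have "AE y in arc_measure i. \<forall>j\<in>nbrs i. y \<in> skel j \<longrightarrow> \<bar>u j y\<bar> \<le> 1"
    by (intro AE_finite_allI finite_nbrs AE_arclengthD[OF bounded i]) (rule nbrs_in)
  moreover note AE_circle_measure_sphere[OF radius_pos[OF i], of "c i", folded bd_eq[OF i]]
  ultimately show ?thesis
  proof eventually_elim
    case (elim y)
    have "y \<in> disk j \<or> y \<notin> cball (c j) (r j)" if "j \<in> nbrs i" for j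
      using elim that bd_eq[OF nbrs_in[OF that]] by (auto simp: disk_def)
    then show ?case using elim skel2_subset_skel[OF i] by blast
  qed
qed

text \<open>The datum is linear in \<open>u\<close>, so the lower bound is the upper bound \<open>datum_le\<close> for \<open>- u\<close>.\<close>

lemma AE_abs_datum_le: "AE y in arc_measure i. \<bar>datum u i y\<bar> \<le> 1"
  using AE_regular_boundary_point
proof eventually_elim
  case (elim y)
  have *: "\<bar>u j y\<bar> \<le> 1" if "j \<in> nbrs i" "y \<in> disk j" for j
    using elim that arc_subset_skel2[OF i that(1)] by blast
  have "datum u i y \<le> 1"
    using elim * by (intro datum_le[OF i]) (auto simp: abs_le_iff)
  moreover have "datum (\<lambda>j y. - u j y) i y \<le> 1"
    using elim * by (intro datum_le[OF i]) (auto simp: abs_le_iff)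
  moreover have "datum (\<lambda>j y. - u j y) i y = - datum u i y"
    by (simp add: datum_def sum_negf)
  ultimately show ?case by linarith
qed

lemma AE_abs_datum_term_le:
  assumes j: "j \<in> nbrs i"
  shows "AE y in arc_measure i. \<bar>indicator (skel2 j i) y * (u j y * chi i j y)\<bar> \<le> 1"
  using AE_regular_boundary_point
proof eventually_elim
  case (elim y)
  show ?case
  proof (cases "y \<in> skel2 j i")
    case True
    then have d: "y \<in> disk j" and u: "\<bar>u j y\<bar> \<le> 1" using elim j skel2_subset[of j i] by blast+
    have "\<bar>chi i j y\<bar> \<le> 1"
      using chi_unit_on_arc[OF i j _ nbrs_in[OF j] d] elim by auto
    then have "\<bar>u j y\<bar> * \<bar>chi i j y\<bar> \<le> 1 * 1" using u by (intro mult_mono) auto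
    then show ?thesis by (simp add: abs_mult True)
  qed simp
qed

lemma datum_measurable: "datum u i \<in> borel_measurable borel"
  unfolding datum_def[abs_def] by (intro borel_measurable_sum datum_term_measurable)

lemma T_op_eq_poisson_integral:
  assumes x: "x \<in> skel_int i"
  shows "T_op chi u i x = (LINT y|arc_measure i. poisson_kernel (c i) (r i) x y * datum u i y)"
proof -
  let ?P = "poisson_kernel (c i) (r i) x"
  have xb: "x \<in> ball (c i) (r i)" using x skel_int_subset_disk[OF i] by (auto simp: disk_def)
  have xs: "x \<in> skel i" using x by (simp add: skel_int_eq)
  have "T_op chi u i x = (\<Sum>j\<in>nbrs i. P_op chi i j (u j) x)"
    unfolding T_op_def T_entry_def using nbrs_subset[of i]
    by (intro sum.mono_neutral_cong_right) auto
  also have "\<dots> = (\<Sum>j\<in>nbrs i. LINT y|arc_measure i. ?P y * (indicator (skel2 j i) y * (u j y * chi i j y)))"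
    using xb xs by (intro sum.cong refl)
      (simp add: P_op_def skel_restrict_def harmonic_extension_def set_lebesgue_integral_def mult.left_commute)
  also have "\<dots> = (LINT y|arc_measure i. (\<Sum>j\<in>nbrs i. ?P y * (indicator (skel2 j i) y * (u j y * chi i j y))))"
    by (rule Bochner_Integration.integral_sum[symmetric])
      (rule integrable_poisson_kernel_times[OF radius_pos[OF i] xb datum_term_measurable AE_abs_datum_term_le])
  finally show ?thesis unfolding datum_def sum_distrib_left .
qed

lemma continuous_on_T_op: "continuous_on (skel_int i) (T_op chi u i)"
proof -
  have "continuous_on (skel_int i) (\<lambda>x. LINT y|arc_measure i. poisson_kernel (c i) (r i) x y * datum u i y)"
    by (rule continuous_on_subset[OF continuous_on_poisson_integral[OF radius_pos[OF i] datum_measurable AE_abs_datum_le]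
        skel_int_subset_disk[OF i, unfolded disk_def]])
  then show ?thesis using T_op_eq_poisson_integral by (simp cong: continuous_on_cong)
qed

lemma abs_T_op_le: "x \<in> skel_int i \<Longrightarrow> \<bar>T_op chi u i x\<bar> \<le> 1"
  using abs_poisson_integral_le[OF radius_pos[OF i] _ datum_measurable AE_abs_datum_le, of x]
    skel_int_subset_disk[OF i] T_op_eq_poisson_integral[of x] by (auto simp: disk_def)

text \<open>Every point of the interior skeleton lies on some circle \<open>k\<close> and approaches one of the two crossing points
  of the circles \<open>i\<close> and \<open>k\<close> nontangentially. As there are finitely many such pairs, the largest of their bounds
  serves for all.\<close>

lemma T_op_uniformly_less_one:
  assumes less: "\<And>j x. j \<in> {1..N} \<Longrightarrow> x \<in> skel_int j \<Longrightarrow> u j x < 1"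
  shows "\<exists>b<1. \<forall>x\<in>skel_int i. T_op chi u i x \<le> b"
proof -
  let ?W = "\<lambda>x. LINT y|arc_measure i. poisson_kernel (c i) (r i) x y * datum u i y"
  note ri = radius_pos[OF i]
  have "\<exists>b<1. \<forall>x. x \<in> bd k \<inter> disk i \<longrightarrow> ?W x \<le> b" if k: "k \<in> nbrs i" for k
  proof -
    obtain K where K: "0 \<le> K" "\<And>x. x \<in> sphere (c k) (r k) \<inter> ball (c i) (r i) \<Longrightarrow>
      \<exists>z\<in>sphere (c i) (r i) \<inter> sphere (c k) (r k). dist x z \<le> K * (r i - dist x (c i))"
      using crossing_nontangential[OF crossing_nbrs[OF i k]] by metis
    have "\<exists>b<1. \<forall>x. x \<in> disk i \<and> dist x z \<le> K * (r i - dist x (c i)) \<longrightarrow> ?W x \<le> b"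
      if z: "z \<in> bd i \<inter> bd k" for z
    proof -
      have "z \<in> sphere (c i) (r i)" using z unfolding bd_eq[OF i] by blast
      then obtain \<theta> where \<theta>: "z = circle_point (c i) (r i) (0 + \<theta>)" by (rule sphere_circle_pointE[OF ri])
      have "circle_point (c i) (r i) (0 + \<theta>) \<in> bd k" using z unfolding \<theta> by blast
      from one_sided_bound[OF i k this cont less] obtain \<sigma> b where \<sigma>: "\<sigma> = 1 \<or> \<sigma> = -1" and b: "b < 1"
        and ev: "\<forall>\<^sub>F t in at_right 0. datum u i (circle_point (c i) (r i) (0 + \<theta> + \<sigma> * t)) \<le> b" by blast
      from ev obtain \<delta> where \<delta>: "0 < \<delta>" 
        "\<And>t. 0 < t \<Longrightarrow> t < \<delta> \<Longrightarrow> datum u i (circle_point (c i) (r i) (0 + \<theta> + \<sigma> * t)) \<le> 1 - (1 - b)"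
        unfolding eventually_at_right_field by auto
      have "0 < 1 - b" using b by simp
      from poisson_integral_le_nontangential[OF ri datum_measurable AE_abs_datum_le K(1) this \<delta>(1) \<sigma> \<delta>(2)]
      show ?thesis unfolding \<theta> disk_def by blast
    qed
    from finite_uniform_bound[OF finite_bd_Int[OF i k],
        where Q = "\<lambda>z x. x \<in> disk i \<and> dist x z \<le> K * (r i - dist x (c i))" and f = ?W, OF this]
    obtain b where b: "b < 1" "\<forall>z\<in>bd i \<inter> bd k. \<forall>x. x \<in> disk i \<and> dist x z \<le> K * (r i - dist x (c i)) \<longrightarrow> ?W x \<le> b" by blast
    have "?W x \<le> b" if x: "x \<in> bd k \<inter> disk i" for x
    proof -
      have "x \<in> sphere (c k) (r k) \<inter> ball (c i) (r i)" using x unfolding bd_eq[OF nbrs_in[OF k]] unfolding disk_def .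
      from K(2)[OF this] obtain z where "z \<in> bd i \<inter> bd k" "dist x z \<le> K * (r i - dist x (c i))"
        unfolding bd_eq[OF i] bd_eq[OF nbrs_in[OF k]] by blast
      then show ?thesis using b(2) x by blast
    qed
    then show ?thesis using b(1) by blast
  qed
  from finite_uniform_bound[OF finite_nbrs, where Q = "\<lambda>k x. x \<in> bd k \<inter> disk i" and f = ?W, OF this]
  obtain b where b: "b < 1" "\<forall>k\<in>nbrs i. \<forall>x. x \<in> bd k \<inter> disk i \<longrightarrow> ?W x \<le> b" by blast
  have "T_op chi u i x \<le> b" if x: "x \<in> skel_int i" for x
  proof -
    obtain k where "k \<in> nbrs i" "x \<in> skel2 i k" using x unfolding skel_int_eq skel_def by blast
    then have "x \<in> bd k \<inter> disk i" using skel2_subset[of i k] x skel_int_subset_disk[OF i] by blast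
    then show ?thesis using b(2) \<open>k \<in> nbrs i\<close> T_op_eq_poisson_integral[OF x] by simp
  qed
  then show ?thesis using b(1) by blast
qed

end

lemma T_op_in_C_set:
  assumes u: "u \<in> V_set N_max"
  shows "T_op chi u \<in> C_set N_max"
proof -
  have cont: "continuous_on (skel_int j) (u j)" if "j \<in> {1..N}" for j using u that by (simp add: V_set_def)
  have "sup_norm u \<le> 1" using u by (simp add: V_set_def)
  then have bounded: "AE x in arclength. x \<in> skel j \<longrightarrow> \<bar>u j x\<bar> \<le> 1" if "j \<in> {1..N}" for j
    using that by (rule sup_norm_le_oneD)
  have less: "u j x < 1" if "j \<in> {1..N}" "x \<in> skel_int j" for j x
    using u that unfolding V_set_def Union_layers by blast
  note contT = continuous_on_T_op[OF _ cont bounded]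
  have "esssup (skel_measure j) (\<lambda>x. ereal \<bar>T_op chi u j x\<bar>) \<le> ereal 1" if "j \<in> {1..N}" for j
    using that by (intro esssup_skel_le continuous_on_rabs contT abs_T_op_le[OF _ cont bounded])
  moreover have "1 \<le> N" using admissible by (simp add: admissible_def)
  ultimately have "sup_norm (T_op chi u) \<le> 1"
    unfolding sup_norm_def by (subst Max_le_iff) (auto simp: one_ereal_def)
  moreover have "esssup (skel_measure j) (\<lambda>x. ereal (T_op chi u j x)) < 1" if j: "j \<in> {1..N}" for j
  proof -
    obtain b where b: "b < 1" "\<forall>x\<in>skel_int j. T_op chi u j x \<le> b"
      using T_op_uniformly_less_one[OF j cont bounded less] by blast
    have "esssup (skel_measure j) (\<lambda>x. ereal (T_op chi u j x)) \<le> ereal b"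
      using b(2) by (intro esssup_skel_le[OF j contT[OF j]]) auto
    then show ?thesis using b(1) by (auto intro: le_less_trans simp: one_ereal_def)
  qed
  ultimately show ?thesis
    unfolding C_set_def Union_layers using contT by blast
qed

end

theorem theorem2p10:
  fixes N :: nat and c :: "nat \<Rightarrow> complex" and r :: "nat \<Rightarrow> real"
    and chi :: "nat \<Rightarrow> nat \<Rightarrow> complex \<Rightarrow> real" and u :: "nat \<Rightarrow> complex \<Rightarrow> real"
  assumes "disks.admissible N c r"
    and "disks.partition_of_unity N c r chi"
    and "u \<in> disks.V_set N c r (disks.N_max N c r)"
  shows "disks.T_op N c r chi u \<in> disks.C_set N c r (disks.N_max N c r)"
proof -
  interpret disks_with_partition N c r chi
    by unfold_locales (fact assms(1,2))+
  show ?thesis using assms(3) by (rule T_op_in_C_set)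
qed

end
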